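(* The fifteen pairs of distinct patterns of length $3$ fall into exactly eleven $\mathsf{iar}$-Wilf-equivalence classes. The pairs $P$ with $|\mathfrak{S}_n(P)|=2^{n-1}$ for all $n\ge 1$ split into the six classes $$\{(132,213),(132,312),(213,231),(231,312),(231,321)\},\ \{(132,231)\},\ \{(213,312)\},\ \{(312,321)\},\ \{(123,132)\},\ \{(123,213)\};$$ the pairs $P$ with $|\mathfrak{S}_n(P)|=1+\binom n2$ for all $n\ge1$ split into the four classes $$\{(132,321)\},\ \{(123,231)\},\ \{(213,321)\},\ \{(123,312)\};$$ and $\{(123,321)\}$ (for which $|\mathfrak{S}_n(123,321)|=0$ when $n\ge5$) is a single class. For $\mathsf{comp}$-Wilf-equivalence, the pairs enumerated by $2^{n-1}$ split into the four classes $$\{(132,231),(132,312),(213,231),(213,312)\},\ \{(132,213)\},\ \{(123,132),(123,213)\},\ \{(231,312),(231,321),(312,321)\},$$ and the pairs enumerated by $1+\binom n2$ split into the two classes $$\{(132,321),(213,321)\},\ \{(123,231),(123,312)\}.$$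
   Context: $\mathfrak{S}_n$ is the set of permutations $\pi=\pi(1)\cdots\pi(n)$ of $[n]=\{1,\dots,n\}$. A permutation $\pi\in\mathfrak{S}_n$ contains the pattern $\sigma\in\mathfrak{S}_k$ if there are $j_1<\cdots<j_k$ such that $\pi(j_a)<\pi(j_b)$ if and only if $\sigma(a)<\sigma(b)$ for all $1\le a<b\le k$; otherwise it avoids $\sigma$. For a pair $P=(\sigma_1,\sigma_2)$ of patterns (order irrelevant), $\mathfrak{S}_n(P)$ is the set of permutations in $\mathfrak{S}_n$ avoiding both $\sigma_1$ and $\sigma_2$. For $\pi\in\mathfrak{S}_n$, $\mathsf{iar}(\pi)$ is the smallest $i\in[n-1]$ with $\pi(i)>\pi(i+1)$, or $n$ if there is no such $i$; and $\mathsf{comp}(\pi)=|\{i\in[n]:\pi(j)\le i\text{ for all }j\le i\}|$. For a statistic $\mathsf{st}$, pairs $P$ and $Q$ are $\mathsf{st}$-Wilf-equivalent if for all $n\ge1$ and every value $v$, the number of $\pi\in\mathfrak{S}_n(P)$ with $\mathsf{st}(\pi)=v$ equals the number of $\pi\in\mathfrak{S}_n(Q)$ with $\mathsf{st}(\pi)=v$. *)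

theory Defs
  imports Main "HOL-Combinatorics.Multiset_Permutations"
begin

text \<open>
  Permutations of \<open>[n]\<close> are written in one-line notation, as elements of
  \<^term>\<open>permutations_of_set {1..n}\<close>. List positions start at 0, so \<open>entry \<pi> i\<close> is the
  one-based value \<open>\<pi>(i)\<close>.
\<close>

abbreviation perms :: "nat \<Rightarrow> nat list set" where
  "perms n \<equiv> permutations_of_set {1..n}"

definition entry :: "nat list \<Rightarrow> nat \<Rightarrow> nat" where
  "entry \<pi> i = \<pi> ! (i - 1)"

definition contains :: "nat list \<Rightarrow> nat list \<Rightarrow> bool" where
  "contains \<pi> \<sigma> \<longleftrightarrow>
     (\<exists>j. strict_mono_on {1..length \<sigma>} j \<and> j ` {1..length \<sigma>} \<subseteq> {1..length \<pi>} \<and>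
       (\<forall>a\<in>{1..length \<sigma>}. \<forall>b\<in>{1..length \<sigma>}. a < b \<longrightarrow>
          (entry \<pi> (j a) < entry \<pi> (j b) \<longleftrightarrow> entry \<sigma> a < entry \<sigma> b)))"

definition avoiders :: "nat \<Rightarrow> nat list set \<Rightarrow> nat list set" where
  "avoiders n P = {\<pi> \<in> perms n. \<forall>\<sigma>\<in>P. \<not> contains \<pi> \<sigma>}"

definition iar :: "nat list \<Rightarrow> nat" where
  "iar \<pi> =
     (if \<exists>i\<in>{1..length \<pi> - 1}. entry \<pi> i > entry \<pi> (i + 1)
      then LEAST i. i \<in> {1..length \<pi> - 1} \<and> entry \<pi> i > entry \<pi> (i + 1)
      else length \<pi>)"

text \<open>The statistic \<open>comp\<close>; that name already denotes function composition.\<close>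

definition comp_stat :: "nat list \<Rightarrow> nat" where
  "comp_stat \<pi> = card {i \<in> {1..length \<pi>}. \<forall>j\<in>{1..i}. entry \<pi> j \<le> i}"

definition st_Wilf_equiv :: "(nat list \<Rightarrow> 'v) \<Rightarrow> nat list set \<Rightarrow> nat list set \<Rightarrow> bool" where
  "st_Wilf_equiv st P Q \<longleftrightarrow>
     (\<forall>n\<ge>1. \<forall>v. card {\<pi> \<in> avoiders n P. st \<pi> = v} = card {\<pi> \<in> avoiders n Q. st \<pi> = v})"

text \<open>A pair of distinct patterns, order irrelevant, is a two-element set.\<close>

definition pairs3 :: "nat list set set" where
  "pairs3 = {P. P \<subseteq> perms 3 \<and> card P = 2}"

definition Wilf_rel :: "(nat list \<Rightarrow> 'v) \<Rightarrow> (nat list set \<times> nat list set) set" where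
  "Wilf_rel st = {(P, Q). P \<in> pairs3 \<and> Q \<in> pairs3 \<and> st_Wilf_equiv st P Q}"

lemma equiv_Wilf_rel: "equiv pairs3 (Wilf_rel st)"
  by (auto simp: equiv_def refl_on_def sym_def trans_def Wilf_rel_def st_Wilf_equiv_def)

text \<open>
  If \<open>A \<subseteq> pairs3\<close>, then \<open>A // Wilf_rel st\<close> is the set of all classes within \<^term>\<open>pairs3\<close>
  that meet \<open>A\<close>.
\<close>

definition pow2_pairs :: "nat list set set" where
  "pow2_pairs = {P \<in> pairs3. \<forall>n\<ge>1. card (avoiders n P) = 2 ^ (n - 1)}"

definition binom_pairs :: "nat list set set" where
  "binom_pairs = {P \<in> pairs3. \<forall>n\<ge>1. card (avoiders n P) = 1 + (n choose 2)}"

end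

theory Submission
  imports Defs "HOL-Library.Sublist"
begin

text \<open>
  Avoiders of a pair of patterns of length three can be built up one entry at a time. Take an avoider
  of length \<open>n\<close>, insert a value at its front or at its back and raise the old entries that are at least
  as large. A new forbidden occurrence must use the inserted entry, so the admissible values (the
  active sites) are described by a condition on pairs of old entries (\<open>front_sites_iff\<close>,
  \<open>back_sites_iff\<close>). For twelve of the fifteen pairs and a suitable choice of the end there are at most
  two active sites; for two more pairs a fixed extreme value is put at either end
  (\<open>generates_ends\<close>). So these fourteen classes are the node sets of trees with at most two children
  at every node.

  Under such an insertion \<open>iar\<close> and \<open>comp\<close> change in a way that depends on little more than their old
  value: a value put in front either prolongs the initial run or makes it 1; a value appended matters
  for the initial run only if the permutation is increasing; and the cuts counted by \<open>comp\<close> survive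
  exactly on one side of the inserted value. So the statistics obey succession rules, after adding
  one or two bits in some classes. Two classes with the same rule have the same distribution at every
  length (\<open>st_mset_eq_level\<close>).

  For \<open>iar\<close>, three pairs follow \<open>rule_reset\<close> and two follow \<open>rule_split\<close>, and these two rules generate the
  same levels (\<open>level_reset\<close>, \<open>level_split\<close>); this is the class of five pairs. For \<open>comp\<close>, the rules
  \<open>rule_reset\<close>, \<open>rule_stay\<close>, \<open>rule_few\<close>, \<open>rule_rise\<close> and \<open>rule_fall\<close> give the five classes with more than one
  element. The rules also count: two children at every node give \<open>2 ^ (n - 1)\<close>, while the last two
  rules, stripped of the component count, give \<open>1 + (n choose 2)\<close> (\<open>size_level_binom\<close>). The remaining pair
  \<open>{123, 321}\<close> dies out at length 5 because of a monotone triple (\<open>avoiders_123_321\<close>).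

  Pairs that are not equivalent are told apart at length 4 already, by the numbers of avoiders with
  statistic 1, 2 and 3 (\<open>profile\<close>). The profile is therefore a complete invariant, and the classes are its
  fibres (\<open>quotient_profile\<close>).
\<close>

section \<open>Occurrences as subsequences\<close>

text \<open>
  Stated for a suffix \<open>drop k xs\<close>, so that rewriting with it peels off the entries of a longer
  subsequence one after the other.
\<close>

lemma subseq_Cons_drop:
  "subseq (y # ys) (drop k xs) \<longleftrightarrow>
     (\<exists>j\<ge>k. j < length xs \<and> xs ! j = y \<and> subseq ys (drop (Suc j) xs))" (is "?L \<longleftrightarrow> ?R")
proof
  assume ?L
  from list_emb_ConsD[OF this] obtain us v vs where
    uv: "drop k xs = us @ v # vs" "y = v" "subseq ys vs" by blast
  have "k + length us < length xs" using arg_cong[OF uv(1), of length] by simp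
  moreover have "xs ! (k + length us) = y"
    using arg_cong[OF uv(1), of "\<lambda>l. l ! length us"] calculation uv(2) by (simp add: nth_append)
  moreover have "drop (Suc (k + length us)) xs = vs"
    using arg_cong[OF uv(1), of "drop (Suc (length us))"] by (simp add: add.commute)
  ultimately show ?R using uv(3) by (intro exI[of _ "k + length us"]) simp
next
  assume ?R
  then obtain j where j: "k \<le> j" "j < length xs" "xs ! j = y" "subseq ys (drop (Suc j) xs)" by blast
  have "subseq (y # ys) (drop j xs)"
    using j(4) unfolding Cons_nth_drop_Suc[OF j(2), symmetric] j(3) by (rule subseq_Cons2)
  moreover have "drop k xs = take (j - k) (drop k xs) @ drop j xs"
    using append_take_drop_id[of "j - k" "drop k xs"] j(1) by simp
  ultimately show ?L by (metis subseq_drop_many)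
qed

lemma subseq2_nth:
  "subseq [x, y] xs \<longleftrightarrow> (\<exists>i j. i < j \<and> j < length xs \<and> xs ! i = x \<and> xs ! j = y)"
proof -
  have "subseq [x, y] (drop 0 xs) \<longleftrightarrow> (\<exists>i j. i < j \<and> j < length xs \<and> xs ! i = x \<and> xs ! j = y)"
    unfolding subseq_Cons_drop by (auto simp: Suc_le_eq intro: less_trans)
  then show ?thesis by simp
qed

lemma subseq3_nth:
  "subseq [x, y, z] xs \<longleftrightarrow>
     (\<exists>i j k. i < j \<and> j < k \<and> k < length xs \<and> xs ! i = x \<and> xs ! j = y \<and> xs ! k = z)" (is "?L \<longleftrightarrow> ?R")
proof -
  have "subseq [x, y, z] (drop 0 xs) \<longleftrightarrow> (\<exists>i<length xs. xs ! i = x \<and> (\<exists>j>i. j < length xs \<and> xs ! j = y \<and>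
      (\<exists>k>j. k < length xs \<and> xs ! k = z)))"
    unfolding subseq_Cons_drop Suc_le_eq by simp
  moreover have "\<dots> \<longleftrightarrow> ?R" (is "?M \<longleftrightarrow> _")
  proof
    assume ?R
    then obtain i j k where "i < j" "j < k" "k < length xs" "xs ! i = x" "xs ! j = y" "xs ! k = z"
      by blast
    moreover from this have "i < length xs" "j < length xs" by simp_all
    ultimately show ?M by blast
  qed blast
  ultimately show ?thesis by simp
qed

text \<open>
  A length-three occurrence is read off from its values in order of appearance. This form recurses
  over the list, whereas the position function of the definition would have to be shifted at every
  insertion.
\<close>

lemma contains3:
  "contains \<pi> [a, b, c] \<longleftrightarrow>
     (\<exists>x y z. subseq [x, y, z] \<pi> \<and> (x < y \<longleftrightarrow> a < b) \<and> (x < z \<longleftrightarrow> a < c) \<and> (y < z \<longleftrightarrow> b < c))"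
  (is "?L \<longleftrightarrow> ?R")
proof
  have I: "{1..length [a, b, c]} = {1, 2, 3}" by auto
  {
    assume ?L
    then obtain j where mono: "strict_mono_on {1..length [a, b, c]} j"
      and rng: "j ` {1..length [a, b, c]} \<subseteq> {1..length \<pi>}"
      and ord: "\<forall>u\<in>{1..length [a, b, c]}. \<forall>v\<in>{1..length [a, b, c]}. u < v \<longrightarrow>
          (entry \<pi> (j u) < entry \<pi> (j v) \<longleftrightarrow> entry [a, b, c] u < entry [a, b, c] v)"
      unfolding contains_def by blast
    have "j 1 < j 2" "j 2 < j 3" using mono unfolding I by (auto simp: strict_mono_on_def)
    moreover have "1 \<le> j 1" "j 3 \<le> length \<pi>" using rng unfolding I by auto
    ultimately have "subseq [\<pi> ! (j 1 - 1), \<pi> ! (j 2 - 1), \<pi> ! (j 3 - 1)] \<pi>"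
      unfolding subseq3_nth
      by (intro exI[of _ "j 1 - 1"] exI[of _ "j 2 - 1"] exI[of _ "j 3 - 1"]) linarith
    moreover have "\<pi> ! (j 1 - 1) < \<pi> ! (j 2 - 1) \<longleftrightarrow> a < b"
      "\<pi> ! (j 1 - 1) < \<pi> ! (j 3 - 1) \<longleftrightarrow> a < c"
      "\<pi> ! (j 2 - 1) < \<pi> ! (j 3 - 1) \<longleftrightarrow> b < c"
      using ord unfolding I by (simp_all add: entry_def)
    ultimately show ?R by blast
  }
  {
    assume ?R
    then obtain i j k where ijk: "i < j" "j < k" "k < length \<pi>"
      "\<pi> ! i < \<pi> ! j \<longleftrightarrow> a < b" "\<pi> ! i < \<pi> ! k \<longleftrightarrow> a < c" "\<pi> ! j < \<pi> ! k \<longleftrightarrow> b < c"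
      unfolding subseq3_nth by blast
    define p where "p = (\<lambda>u::nat. if u = 1 then Suc i else if u = 2 then Suc j else Suc k)"
    have p: "p 1 = Suc i" "p (Suc 0) = Suc i" "p 2 = Suc j" "p 3 = Suc k" by (simp_all add: p_def)
    have "strict_mono_on {1, 2, 3} p"
      unfolding strict_mono_on_def using ijk(1,2) p by force
    moreover have "p ` {1, 2, 3} \<subseteq> {1..length \<pi>}" using ijk(1-3) p by auto
    moreover have "\<forall>u\<in>{1, 2, 3}. \<forall>v\<in>{1, 2, 3}. u < v \<longrightarrow>
        (entry \<pi> (p u) < entry \<pi> (p v) \<longleftrightarrow> entry [a, b, c] u < entry [a, b, c] v)"
      using ijk(4-6) by (simp add: p entry_def)
    ultimately show ?L unfolding contains_def I by blast
  }
qed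

lemma permsD:
  assumes "\<pi> \<in> perms n"
  shows "distinct \<pi>" "set \<pi> = {1..n}" "length \<pi> = n"
  using permutations_of_setD[OF assms] length_finite_permutations_of_set[OF assms] by auto

lemma subseq2_total:
  assumes "x \<in> set xs" "y \<in> set xs" "x \<noteq> y"
  shows "subseq [x, y] xs \<or> subseq [y, x] xs"
proof -
  obtain i j where "i < length xs" "xs ! i = x" "j < length xs" "xs ! j = y"
    using assms by (auto simp: in_set_conv_nth)
  moreover from this have "i < j \<or> j < i" using assms(3) by (metis linorder_neqE_nat)
  ultimately show ?thesis unfolding subseq2_nth by blast
qed

lemma subseq2D:
  assumes "subseq [x, y] xs" "distinct xs"
  shows "x \<in> set xs" "y \<in> set xs" "x \<noteq> y" "\<not> subseq [y, x] xs"
proof -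
  obtain i j where ij: "i < j" "j < length xs" "xs ! i = x" "xs ! j = y"
    using assms(1) unfolding subseq2_nth by blast
  then show "x \<in> set xs" "y \<in> set xs" by auto
  show "x \<noteq> y" using ij assms(2) by (auto simp: nth_eq_iff_index_eq)
  show "\<not> subseq [y, x] xs"
  proof
    assume "subseq [y, x] xs"
    then obtain k l where "k < l" "l < length xs" "xs ! k = y" "xs ! l = x"
      unfolding subseq2_nth by blast
    with ij assms(2) have "k = j" "l = i" by (metis nth_eq_iff_index_eq less_trans)+
    with ij \<open>k < l\<close> show False by simp
  qed
qed

lemma subseq_hd:
  assumes "xs \<noteq> []" "distinct xs"
  shows "y \<in> set xs \<Longrightarrow> y \<noteq> hd xs \<Longrightarrow> subseq [hd xs, y] xs"
    and "\<not> subseq [y, hd xs] xs"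
    and "subseq [y, z] xs \<Longrightarrow> y \<noteq> hd xs \<Longrightarrow> subseq [hd xs, y, z] xs"
proof -
  obtain x ys where xs: "xs = x # ys" using assms(1) by (cases xs) auto
  then have x: "x \<notin> set ys" using assms(2) by simp
  show "subseq [hd xs, y] xs" if "y \<in> set xs" "y \<noteq> hd xs"
    using that xs by (simp add: subseq_singleton_left)
  show "\<not> subseq [y, hd xs] xs"
    using x xs subseq_Cons'[of y "[x]" ys] by (auto simp: subseq_singleton_left)
  show "subseq [hd xs, y, z] xs" if "subseq [y, z] xs" "y \<noteq> hd xs"
    using that xs by simp
qed

lemma subseq_snoc2: "subseq [x, y] (xs @ [v]) \<longleftrightarrow> subseq [x, y] xs \<or> (x \<in> set xs \<and> y = v)"
proof (induction xs)
  case (Cons a xs)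
  then show ?case
    using subseq_Cons'[of x "[y]" xs] by (simp add: subseq_singleton_left) blast
qed simp

lemma subseq_snoc3: "subseq [x, y, z] (xs @ [v]) \<longleftrightarrow> subseq [x, y, z] xs \<or> (subseq [x, y] xs \<and> z = v)"
  by (induction xs) (simp_all add: subseq_snoc2 subseq_singleton_left)

lemma subseq_last:
  assumes "xs \<noteq> []" "distinct xs"
  shows "y \<in> set xs \<Longrightarrow> y \<noteq> last xs \<Longrightarrow> subseq [y, last xs] xs"
    and "\<not> subseq [last xs, y] xs"
    and "subseq [y, z] xs \<Longrightarrow> z \<noteq> last xs \<Longrightarrow> subseq [y, z, last xs] xs"
proof -
  obtain x ys where xs: "xs = ys @ [x]" using assms(1) by (cases xs rule: rev_cases) auto
  then have x: "x \<notin> set ys" "distinct ys" using assms(2) by simp_all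
  show "subseq [y, last xs] xs" if "y \<in> set xs" "y \<noteq> last xs"
    using that xs by (simp add: subseq_snoc2)
  show "\<not> subseq [last xs, y] xs"
    using x xs subseq2D(1)[of x y ys] by (auto simp: subseq_snoc2)
  show "subseq [y, z, last xs] xs" if "subseq [y, z] xs" "z \<noteq> last xs"
    using that xs by (auto simp: subseq_snoc2 subseq_snoc3)
qed

lemma subseq2_map:
  "subseq [x, y] (map f xs) \<longleftrightarrow> (\<exists>x' y'. subseq [x', y'] xs \<and> x = f x' \<and> y = f y')" (is "?L \<longleftrightarrow> ?R")
proof
  assume ?L
  then obtain i j where ij: "i < j" "j < length xs" "map f xs ! i = x" "map f xs ! j = y"
    unfolding subseq2_nth length_map by blast
  then have "subseq [xs ! i, xs ! j] xs" unfolding subseq2_nth by blast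
  then show ?R using ij by auto
next
  assume ?R
  then show ?L using subseq_map by fastforce
qed

lemma subseq3_map:
  "subseq [x, y, z] (map f xs) \<longleftrightarrow>
     (\<exists>x' y' z'. subseq [x', y', z'] xs \<and> x = f x' \<and> y = f y' \<and> z = f z')" (is "?L \<longleftrightarrow> ?R")
proof
  assume ?L
  then obtain i j k where ij: "i < j" "j < k" "k < length xs"
    "map f xs ! i = x" "map f xs ! j = y" "map f xs ! k = z"
    unfolding subseq3_nth length_map by blast
  then have "subseq [xs ! i, xs ! j, xs ! k] xs" unfolding subseq3_nth by blast
  then show ?R using ij by auto
next
  assume ?R
  then show ?L using subseq_map by fastforce
qed

section \<open>Inserting a value at either end\<close>

text \<open>
  Inserting the value \<open>v\<close> into a permutation of \<open>[n]\<close> raises the old entries that are at least \<open>v\<close>.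
  The relative order of the old entries does not change, and the result is a permutation of
  \<open>[n + 1]\<close>.
\<close>

definition bump :: "nat \<Rightarrow> nat \<Rightarrow> nat" where
  "bump v x = (if v \<le> x then Suc x else x)"

definition prepend :: "nat \<Rightarrow> nat list \<Rightarrow> nat list" where
  "prepend v \<pi> = v # map (bump v) \<pi>"

definition postpend :: "nat \<Rightarrow> nat list \<Rightarrow> nat list" where
  "postpend v \<pi> = map (bump v) \<pi> @ [v]"

lemma bump_less [simp]: "bump v x < bump v y \<longleftrightarrow> x < y"
  by (auto simp: bump_def)

lemma bump_less_self [simp]: "bump v x < v \<longleftrightarrow> x < v" "v < bump v x \<longleftrightarrow> v \<le> x"
  by (auto simp: bump_def)

lemma bump_eq [simp]: "bump v x = bump v y \<longleftrightarrow> x = y" "bump v x \<noteq> v"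
  by (auto simp: bump_def)

lemma inj_bump: "inj (bump v)"
  by (simp add: inj_def)

lemma pre_eq_iff: "prepend v \<pi> = prepend w \<rho> \<longleftrightarrow> v = w \<and> \<pi> = \<rho>"
  by (auto simp: prepend_def inj_map_eq_map[OF inj_bump])

lemma app_eq_iff: "postpend v \<pi> = postpend w \<rho> \<longleftrightarrow> v = w \<and> \<pi> = \<rho>"
  by (auto simp: postpend_def inj_map_eq_map[OF inj_bump])

lemma bump_image:
  assumes "v \<in> {1..Suc n}"
  shows "bump v ` {1..n} = {1..Suc n} - {v}"
proof (intro card_subset_eq)
  show "bump v ` {1..n} \<subseteq> {1..Suc n} - {v}" by (auto simp: bump_def)
  show "card (bump v ` {1..n}) = card ({1..Suc n} - {v})"
    using assms by (subst card_image) (auto intro: inj_on_subset[OF inj_bump])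
qed simp

lemma perms_Suc_pre: "perms (Suc n) = (\<Union>v\<in>{1..Suc n}. prepend v ` perms n)"
proof -
  have "perms (Suc n) = (\<Union>v\<in>{1..Suc n}. (#) v ` permutations_of_set ({1..Suc n} - {v}))"
    by (rule permutations_of_set_nonempty) auto
  also have "\<dots> = (\<Union>v\<in>{1..Suc n}. (#) v ` map (bump v) ` perms n)"
    by (intro SUP_cong refl, subst permutations_of_set_image_inj[symmetric])
       (auto simp only: bump_image intro: inj_on_subset[OF inj_bump])
  finally show ?thesis by (auto simp: prepend_def image_image)
qed

lemma app_conv_pre: "postpend v = (\<lambda>\<pi>. rev (prepend v (rev \<pi>)))"
  by (simp add: postpend_def prepend_def rev_map fun_eq_iff)

lemma perms_Suc_app: "perms (Suc n) = (\<Union>v\<in>{1..Suc n}. postpend v ` perms n)"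
proof -
  have "perms (Suc n) = rev ` perms (Suc n)" by simp
  also have "\<dots> = (\<Union>v\<in>{1..Suc n}. (\<lambda>\<pi>. rev (prepend v \<pi>)) ` perms n)"
    by (simp only: perms_Suc_pre image_UN image_image)
  also have "\<dots> = (\<Union>v\<in>{1..Suc n}. (\<lambda>\<pi>. rev (prepend v \<pi>)) ` rev ` perms n)" by simp
  also have "\<dots> = (\<Union>v\<in>{1..Suc n}. postpend v ` perms n)"
    by (simp only: image_image app_conv_pre)
  finally show ?thesis .
qed

text \<open>
  The old entries keep their relative order, so a new occurrence must use the inserted entry. What
  remains is a condition on pairs of old entries.
\<close>

lemma contains_prepend: "contains (prepend v \<pi>) [a, b, c] \<longleftrightarrow> contains \<pi> [a, b, c] \<or>
    (\<exists>y z. subseq [y, z] \<pi> \<and> (v \<le> y \<longleftrightarrow> a < b) \<and> (v \<le> z \<longleftrightarrow> a < c) \<and> (y < z \<longleftrightarrow> b < c))"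
    (is "_ \<longleftrightarrow> contains _ _ \<or> ?new")
proof -
  define Q where "Q = (\<lambda>(x::nat) y z. (x < y \<longleftrightarrow> a < b) \<and> (x < z \<longleftrightarrow> a < c) \<and> (y < z \<longleftrightarrow> b < c))"
  have "subseq [x, y, z] (prepend v \<pi>) \<longleftrightarrow> subseq [x, y, z] (map (bump v) \<pi>) \<or>
      (x = v \<and> subseq [y, z] (map (bump v) \<pi>))" for x y z
    unfolding prepend_def subseq_Cons2_iff using subseq_Cons'[of x "[y, z]" "map (bump v) \<pi>"] by auto
  then have "contains (prepend v \<pi>) [a, b, c] \<longleftrightarrow>
      (\<exists>x y z. subseq [x, y, z] (map (bump v) \<pi>) \<and> Q x y z) \<or>
      (\<exists>y z. subseq [y, z] (map (bump v) \<pi>) \<and> Q v y z)"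
    unfolding contains3 Q_def by blast
  also have "(\<exists>x y z. subseq [x, y, z] (map (bump v) \<pi>) \<and> Q x y z) \<longleftrightarrow>
      (\<exists>x y z. subseq [x, y, z] \<pi> \<and> Q (bump v x) (bump v y) (bump v z))"
    unfolding subseq3_map by blast
  also have "\<dots> \<longleftrightarrow> contains \<pi> [a, b, c]" by (simp add: Q_def contains3)
  also have "(\<exists>y z. subseq [y, z] (map (bump v) \<pi>) \<and> Q v y z) \<longleftrightarrow>
      (\<exists>y z. subseq [y, z] \<pi> \<and> Q v (bump v y) (bump v z))"
    unfolding subseq2_map by blast
  also have "\<dots> \<longleftrightarrow> ?new" by (simp add: Q_def)
  finally show ?thesis .
qed

lemma contains_postpend: "contains (postpend v \<pi>) [a, b, c] \<longleftrightarrow> contains \<pi> [a, b, c] \<or>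
    (\<exists>x y. subseq [x, y] \<pi> \<and> (x < y \<longleftrightarrow> a < b) \<and> (x < v \<longleftrightarrow> a < c) \<and> (y < v \<longleftrightarrow> b < c))"
    (is "_ \<longleftrightarrow> contains _ _ \<or> ?new")
proof -
  define Q where "Q = (\<lambda>(x::nat) y z. (x < y \<longleftrightarrow> a < b) \<and> (x < z \<longleftrightarrow> a < c) \<and> (y < z \<longleftrightarrow> b < c))"
  have "contains (postpend v \<pi>) [a, b, c] \<longleftrightarrow>
      (\<exists>x y z. subseq [x, y, z] (map (bump v) \<pi>) \<and> Q x y z) \<or>
      (\<exists>x y. subseq [x, y] (map (bump v) \<pi>) \<and> Q x y v)"
    unfolding contains3 Q_def postpend_def subseq_snoc3 by blast
  also have "(\<exists>x y z. subseq [x, y, z] (map (bump v) \<pi>) \<and> Q x y z) \<longleftrightarrow>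
      (\<exists>x y z. subseq [x, y, z] \<pi> \<and> Q (bump v x) (bump v y) (bump v z))"
    unfolding subseq3_map by blast
  also have "\<dots> \<longleftrightarrow> contains \<pi> [a, b, c]" by (simp add: Q_def contains3)
  also have "(\<exists>x y. subseq [x, y] (map (bump v) \<pi>) \<and> Q x y v) \<longleftrightarrow>
      (\<exists>x y. subseq [x, y] \<pi> \<and> Q (bump v x) (bump v y) v)"
    unfolding subseq2_map by blast
  also have "\<dots> \<longleftrightarrow> ?new" by (simp add: Q_def)
  finally show ?thesis .
qed

section \<open>Generating trees\<close>

text \<open>
  \<open>ch\<close> lists the children of a permutation in a tree whose levels are the classes of avoiders. Every
  avoider has a unique parent, and therefore a sum over a level is a sum over the level before it.
\<close>

definition generates :: "(nat list \<Rightarrow> nat list set) \<Rightarrow> nat list set \<Rightarrow> bool" where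
  "generates ch P \<longleftrightarrow> (\<forall>n\<ge>1. avoiders (Suc n) P = (\<Union>\<pi>\<in>avoiders n P. ch \<pi>) \<and>
     (\<forall>\<pi>\<in>avoiders n P. finite (ch \<pi>)) \<and> disjoint_family_on ch (avoiders n P))"

definition st_mset :: "(nat list \<Rightarrow> 'v) \<Rightarrow> nat \<Rightarrow> nat list set \<Rightarrow> 'v multiset" where
  "st_mset T n P = image_mset T (mset_set (avoiders n P))"

text \<open>
  A succession rule: the statistics of the children depend only on the length \<open>n\<close> and on the statistic
  of the parent. The statistic may have to be refined by auxiliary bits before this becomes true.
\<close>

definition follows :: "(nat list \<Rightarrow> nat list set) \<Rightarrow> nat list set \<Rightarrow> (nat list \<Rightarrow> 'v) \<Rightarrow>
    (nat \<Rightarrow> 'v \<Rightarrow> 'v multiset) \<Rightarrow> bool" where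
  "follows ch P T H \<longleftrightarrow>
     (\<forall>n\<ge>1. \<forall>\<pi>\<in>avoiders n P. image_mset T (mset_set (ch \<pi>)) = H n (T \<pi>))"

text \<open>
  The index is one less than the length: the root of every tree is the permutation of length 1.
\<close>

primrec level :: "(nat \<Rightarrow> 'v \<Rightarrow> 'v multiset) \<Rightarrow> 'v \<Rightarrow> nat \<Rightarrow> 'v multiset" where
  "level H t 0 = {#t#}"
| "level H t (Suc n) = (\<Sum>s\<in>#level H t n. H (Suc n) s)"

lemma finite_avoiders [simp]: "finite (avoiders n P)"
  unfolding avoiders_def by (rule finite_subset[of _ "perms n"]) auto

lemma avoidersD: "\<pi> \<in> avoiders n P \<Longrightarrow> \<pi> \<in> perms n" "\<pi> \<in> avoiders n P \<Longrightarrow> \<sigma> \<in> P \<Longrightarrow> \<not> contains \<pi> \<sigma>"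
  by (auto simp: avoiders_def)

lemma image_mset_mset_set_UN:
  assumes "finite A" "\<And>x. x \<in> A \<Longrightarrow> finite (B x)" "disjoint_family_on B A"
  shows "image_mset f (mset_set (\<Union>x\<in>A. B x)) = (\<Sum>x\<in>A. image_mset f (mset_set (B x)))"
  using assms
proof (induction A rule: finite_induct)
  case (insert a A)
  have "mset_set (B a \<union> (\<Union>x\<in>A. B x)) = mset_set (B a) + mset_set (\<Union>x\<in>A. B x)"
    using insert by (intro mset_set_Union) (auto simp: disjoint_family_on_def)
  then show ?case using insert by (auto simp: disjoint_family_on_def)
qed simp

lemma three_letter_patterns:
  assumes "P \<subseteq> perms 3" "\<sigma> \<in> P"
  obtains a b c where "\<sigma> = [a, b, c]"
proof -
  have "length \<sigma> = 3" using assms permsD(3) by blast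
  then show ?thesis using that by (auto simp: numeral_3_eq_3 length_Suc_conv)
qed

lemma avoiders_1:
  assumes "P \<subseteq> perms 3"
  shows "avoiders 1 P = {[1]}"
proof -
  have "\<not> contains [1] \<sigma>" if "\<sigma> \<in> P" for \<sigma>
    using three_letter_patterns[OF assms that] by (metis contains3 length_Cons list.size(3)
      not_subseq_length lessI less_Suc_eq)
  then show ?thesis by (auto simp: avoiders_def)
qed

text \<open>
  This is why two classes that follow the same rule are equidistributed: the distribution at every
  length is computed from the rule and from the statistic of the root, without reference to the
  patterns.
\<close>

lemma st_mset_eq_level:
  assumes "P \<subseteq> perms 3" "generates ch P" "follows ch P T H"
  shows "st_mset T (Suc n) P = level H (T [1]) n"
proof (induction n)
  case 0
  then show ?case using avoiders_1[OF assms(1)] by (simp add: st_mset_def)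
next
  case (Suc n)
  let ?A = "avoiders (Suc n) P"
  have g: "avoiders (Suc (Suc n)) P = (\<Union>\<pi>\<in>?A. ch \<pi>)" "\<And>\<pi>. \<pi> \<in> ?A \<Longrightarrow> finite (ch \<pi>)"
    "disjoint_family_on ch ?A"
    using assms(2) unfolding generates_def by auto
  have "st_mset T (Suc (Suc n)) P = (\<Sum>\<pi>\<in>?A. image_mset T (mset_set (ch \<pi>)))"
    unfolding st_mset_def g(1) using g by (intro image_mset_mset_set_UN) auto
  also have "\<dots> = (\<Sum>\<pi>\<in>?A. H (Suc n) (T \<pi>))"
    using assms(3) by (intro sum.cong) (auto simp: follows_def)
  also have "\<dots> = (\<Sum>s\<in>#st_mset T (Suc n) P. H (Suc n) s)"
    by (simp add: st_mset_def sum_unfold_sum_mset image_mset.compositionality o_def)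
  also have "\<dots> = level H (T [1]) (Suc n)" using Suc by simp
  finally show ?case .
qed

text \<open>
  The active sites of a permutation: the values whose insertion at the front (or at the back) keeps
  all patterns of \<open>P\<close> away.
\<close>

definition front_sites :: "nat list set \<Rightarrow> nat list \<Rightarrow> nat set" where
  "front_sites P \<pi> = {v \<in> {1..Suc (length \<pi>)}. \<forall>\<sigma>\<in>P. \<not> contains (prepend v \<pi>) \<sigma>}"

definition back_sites :: "nat list set \<Rightarrow> nat list \<Rightarrow> nat set" where
  "back_sites P \<pi> = {v \<in> {1..Suc (length \<pi>)}. \<forall>\<sigma>\<in>P. \<not> contains (postpend v \<pi>) \<sigma>}"

abbreviation front_children :: "nat list set \<Rightarrow> nat list \<Rightarrow> nat list set" where
  "front_children P \<pi> \<equiv> (\<lambda>v. prepend v \<pi>) ` front_sites P \<pi>"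

abbreviation back_children :: "nat list set \<Rightarrow> nat list \<Rightarrow> nat list set" where
  "back_children P \<pi> \<equiv> (\<lambda>v. postpend v \<pi>) ` back_sites P \<pi>"

text \<open>
  Deleting the first entry never creates an occurrence, and the deleted value together with the rest
  determines the permutation. So inserting at the active sites reaches every avoider exactly once.
\<close>

lemma generates_front:
  assumes "P \<subseteq> perms 3"
  shows "generates (front_children P) P"
proof -
  have up: "contains (prepend v \<pi>) \<sigma>" if "contains \<pi> \<sigma>" "\<sigma> \<in> P" for v \<pi> \<sigma>
    using three_letter_patterns[OF assms that(2)] that(1) contains_prepend by metis
  have "avoiders (Suc n) P = (\<Union>\<pi>\<in>avoiders n P. front_children P \<pi>)" for n
  proof (intro set_eqI iffI)
    fix \<rho> assume "\<rho> \<in> avoiders (Suc n) P"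
    then have r: "\<rho> \<in> perms (Suc n)" "\<forall>\<sigma>\<in>P. \<not> contains \<rho> \<sigma>" by (simp_all add: avoiders_def)
    then obtain v \<pi> where v: "v \<in> {1..Suc n}" "\<pi> \<in> perms n" "\<rho> = prepend v \<pi>"
      unfolding perms_Suc_pre by blast
    have "\<pi> \<in> avoiders n P" using v r up by (auto simp only: avoiders_def mem_Collect_eq)
    moreover have "v \<in> front_sites P \<pi>"
      using v r permsD(3)[OF v(2)] by (simp only: front_sites_def mem_Collect_eq simp_thms)
    ultimately show "\<rho> \<in> (\<Union>\<pi>\<in>avoiders n P. front_children P \<pi>)" using v(3) by blast
  next
    fix \<rho> assume "\<rho> \<in> (\<Union>\<pi>\<in>avoiders n P. front_children P \<pi>)"
    then obtain v \<pi> where v: "\<pi> \<in> avoiders n P" "v \<in> front_sites P \<pi>" "\<rho> = prepend v \<pi>" by blast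
    have "\<pi> \<in> perms n" using v(1) by (rule avoidersD)
    moreover from this have "v \<in> {1..Suc n}" using v(2) permsD(3) by (auto simp only: front_sites_def mem_Collect_eq)
    ultimately have "\<rho> \<in> perms (Suc n)" unfolding perms_Suc_pre v(3) by blast
    then show "\<rho> \<in> avoiders (Suc n) P" using v(2,3) by (simp add: avoiders_def front_sites_def)
  qed
  moreover have "disjoint_family_on (front_children P) (avoiders n P)" for n
    by (auto simp: disjoint_family_on_def pre_eq_iff)
  ultimately show ?thesis unfolding generates_def by (auto simp: front_sites_def)
qed

lemma generates_back:
  assumes "P \<subseteq> perms 3"
  shows "generates (back_children P) P"
proof -
  have up: "contains (postpend v \<pi>) \<sigma>" if "contains \<pi> \<sigma>" "\<sigma> \<in> P" for v \<pi> \<sigma>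
    using three_letter_patterns[OF assms that(2)] that(1) contains_postpend by metis
  have "avoiders (Suc n) P = (\<Union>\<pi>\<in>avoiders n P. back_children P \<pi>)" for n
  proof (intro set_eqI iffI)
    fix \<rho> assume "\<rho> \<in> avoiders (Suc n) P"
    then have r: "\<rho> \<in> perms (Suc n)" "\<forall>\<sigma>\<in>P. \<not> contains \<rho> \<sigma>" by (simp_all add: avoiders_def)
    then obtain v \<pi> where v: "v \<in> {1..Suc n}" "\<pi> \<in> perms n" "\<rho> = postpend v \<pi>"
      unfolding perms_Suc_app by blast
    have "\<pi> \<in> avoiders n P" using v r up by (auto simp only: avoiders_def mem_Collect_eq)
    moreover have "v \<in> back_sites P \<pi>"
      using v r permsD(3)[OF v(2)] by (simp only: back_sites_def mem_Collect_eq simp_thms)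
    ultimately show "\<rho> \<in> (\<Union>\<pi>\<in>avoiders n P. back_children P \<pi>)" using v(3) by blast
  next
    fix \<rho> assume "\<rho> \<in> (\<Union>\<pi>\<in>avoiders n P. back_children P \<pi>)"
    then obtain v \<pi> where v: "\<pi> \<in> avoiders n P" "v \<in> back_sites P \<pi>" "\<rho> = postpend v \<pi>" by blast
    have "\<pi> \<in> perms n" using v(1) by (rule avoidersD)
    moreover from this have "v \<in> {1..Suc n}" using v(2) permsD(3) by (auto simp only: back_sites_def mem_Collect_eq)
    ultimately have "\<rho> \<in> perms (Suc n)" unfolding perms_Suc_app v(3) by blast
    then show "\<rho> \<in> avoiders (Suc n) P" using v(2,3) by (simp add: avoiders_def back_sites_def)
  qed
  moreover have "disjoint_family_on (back_children P) (avoiders n P)" for n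
    by (auto simp: disjoint_family_on_def app_eq_iff)
  ultimately show ?thesis unfolding generates_def by (auto simp: back_sites_def)
qed

lemma follows_frontI:
  assumes "\<And>n \<pi>. 1 \<le> n \<Longrightarrow> \<pi> \<in> avoiders n P \<Longrightarrow>
    image_mset (\<lambda>v. T (prepend v \<pi>)) (mset_set (front_sites P \<pi>)) = H n (T \<pi>)"
  shows "follows (front_children P) P T H"
proof -
  have "image_mset T (mset_set (front_children P \<pi>)) =
      image_mset (\<lambda>v. T (prepend v \<pi>)) (mset_set (front_sites P \<pi>))" for \<pi>
    by (subst image_mset_mset_set[symmetric])
       (auto simp: inj_on_def pre_eq_iff image_mset.compositionality o_def)
  then show ?thesis using assms by (simp add: follows_def)
qed

lemma follows_backI:
  assumes "\<And>n \<pi>. 1 \<le> n \<Longrightarrow> \<pi> \<in> avoiders n P \<Longrightarrow>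
    image_mset (\<lambda>v. T (postpend v \<pi>)) (mset_set (back_sites P \<pi>)) = H n (T \<pi>)"
  shows "follows (back_children P) P T H"
proof -
  have "image_mset T (mset_set (back_children P \<pi>)) =
      image_mset (\<lambda>v. T (postpend v \<pi>)) (mset_set (back_sites P \<pi>))" for \<pi>
    by (subst image_mset_mset_set[symmetric])
       (auto simp: inj_on_def app_eq_iff image_mset.compositionality o_def)
  then show ?thesis using assms by (simp add: follows_def)
qed

section \<open>The two statistics under insertion\<close>

lemma iar_single [simp]: "iar [x] = 1"
  by (simp add: iar_def)

lemma iar_Cons2: "iar (x # y # zs) = (if x > y then 1 else Suc (iar (y # zs)))"
proof -
  define Q where "Q = (\<lambda>xs i. i \<in> {1..length xs - 1} \<and> entry xs i > entry xs (i + 1))"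
  have iar: "iar xs = (if \<exists>i. Q xs i then LEAST i. Q xs i else length xs)" for xs
    unfolding iar_def Q_def by (rule if_cong) auto
  have one: "Q (x # y # zs) (Suc 0) \<longleftrightarrow> x > y" by (simp add: Q_def entry_def)
  have zero: "\<not> Q xs 0" for xs by (simp add: Q_def)
  show ?thesis
  proof (cases "x > y")
    case True
    with one have "Q (x # y # zs) (Suc 0)" by simp
    moreover have "(LEAST i. Q (x # y # zs) i) = Suc 0"
      using calculation zero by (intro Least_equality) (auto simp: Suc_le_eq intro!: gr0I)
    ultimately show ?thesis using True by (auto simp: iar)
  next
    case False
    have sh: "Q (x # y # zs) (Suc i) \<longleftrightarrow> Q (y # zs) i" for i
    proof (cases i)
      case 0
      then show ?thesis using one False zero by simp
    next
      case (Suc j)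
      then show ?thesis by (auto simp: Q_def entry_def)
    qed
    have ex: "(\<exists>i. Q (x # y # zs) i) \<longleftrightarrow> (\<exists>i. Q (y # zs) i)"
      using sh zero by (metis not0_implies_Suc)
    have "(LEAST i. Q (x # y # zs) i) = Suc (LEAST i. Q (y # zs) i)" if "Q (y # zs) i" for i
      using Least_Suc[of "Q (x # y # zs)" "Suc i"] that sh zero by simp
    with ex False show ?thesis by (auto simp: iar)
  qed
qed

lemma iar_map_bump [simp]: "iar (map (bump v) xs) = iar xs"
  by (induction xs rule: induct_list012) (simp_all add: iar_Cons2)

lemma iar_pre:
  assumes "\<pi> \<noteq> []"
  shows "iar (prepend v \<pi>) = (if v \<le> hd \<pi> then Suc (iar \<pi>) else 1)"
proof -
  obtain x xs where "\<pi> = x # xs" using assms by (cases \<pi>) auto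
  then show ?thesis
    using iar_map_bump[of v "x # xs"] by (simp add: prepend_def iar_Cons2 not_le del: iar_map_bump)
qed

lemma iar_full_last: "iar xs = length xs \<Longrightarrow> x \<in> set xs \<Longrightarrow> x \<le> last xs"
proof (induction xs arbitrary: x rule: induct_list012)
  case (3 u v ys)
  then have "u \<le> v" "iar (v # ys) = length (v # ys)" by (auto simp: iar_Cons2 split: if_splits)
  with 3 show ?case by (auto intro: order.trans)
qed auto

lemma iar_snoc:
  assumes "xs \<noteq> []"
  shows "iar (xs @ [v]) = (if iar xs = length xs \<and> last xs \<le> v then Suc (length xs) else iar xs)"
  using assms
proof (induction xs rule: induct_list012)
  case (3 x y zs)
  show ?case using 3(2) by (auto simp: iar_Cons2)
qed (auto simp: iar_Cons2)

text \<open>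
  An appended value can only matter when the initial run is the whole permutation, and then the last
  entry is \<open>n\<close>.
\<close>

lemma iar_app:
  assumes "\<pi> \<in> perms n" "1 \<le> n"
  shows "iar (postpend v \<pi>) = (if iar \<pi> = n \<and> n < v then Suc n else iar \<pi>)"
proof -
  have ne: "\<pi> \<noteq> []" using permsD(3)[OF assms(1)] assms(2) by auto
  have last: "last \<pi> = n" if "iar \<pi> = n"
  proof -
    have "n \<le> last \<pi>" using iar_full_last[of \<pi> n] that permsD[OF assms(1)] assms(2) by auto
    moreover have "last \<pi> \<le> n" using permsD(2)[OF assms(1)] last_in_set[OF ne] by auto
    ultimately show ?thesis by simp
  qed
  have "bump v n \<le> v \<longleftrightarrow> n < v" by (auto simp: bump_def)
  then show ?thesis
    using last ne permsD(3)[OF assms(1)] by (auto simp: postpend_def iar_snoc last_map)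
qed

text \<open>
  For \<open>1 \<le> i \<le> n\<close> these are the positions counted by \<open>comp\<close>; the cut at 0 is allowed because
  inserting 1 at the front turns it into a counted one.
\<close>

definition cut_at :: "nat \<Rightarrow> nat list \<Rightarrow> bool" where
  "cut_at i \<pi> \<longleftrightarrow> (\<forall>x\<in>set (take i \<pi>). x \<le> i)"

lemma comp_stat_cut: "comp_stat \<pi> = card {i \<in> {1..length \<pi>}. cut_at i \<pi>}"
proof -
  have "(\<forall>j\<in>{1..i}. entry \<pi> j \<le> i) \<longleftrightarrow> cut_at i \<pi>" if "i \<le> length \<pi>" for i
  proof -
    have "{1..i} = Suc ` {0..<i}" by (simp add: atLeastLessThanSuc_atLeastAtMost)
    then have "entry \<pi> ` {1..i} = (!) \<pi> ` {0..<i}"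
      by (simp only: image_image entry_def diff_Suc_1)
    also have "\<dots> = set (take i \<pi>)" using that by (rule nth_image)
    finally have *: "set (take i \<pi>) = entry \<pi> ` {1..i}" ..
    show ?thesis unfolding cut_at_def * by blast
  qed
  then show ?thesis unfolding comp_stat_def by (intro arg_cong[of _ _ card]) auto
qed

text \<open>
  The first \<open>i\<close> entries of a permutation are \<open>i\<close> distinct numbers. If all of them are at most \<open>i\<close>, they
  exhaust \<open>{1..i}\<close> and no small entry is left for later; if one exceeds \<open>i\<close>, some small entry is missing
  among them and comes later. This expresses cuts by pairs of entries, like the active sites.
\<close>

lemma cut_iff_subseq:
  assumes "\<pi> \<in> perms n" "i \<le> n"
  shows "cut_at i \<pi> \<longleftrightarrow> (\<forall>a b. subseq [b, a] \<pi> \<longrightarrow> \<not> (a \<le> i \<and> i < b))"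
proof
  note p = permsD[OF assms(1)]
  have split: "set \<pi> = set (take i \<pi>) \<union> set (drop i \<pi>)"
    using set_append[of "take i \<pi>" "drop i \<pi>"] by simp
  have card: "card (set (take i \<pi>)) = i" using p assms(2) by (simp add: distinct_card)
  show "\<forall>a b. subseq [b, a] \<pi> \<longrightarrow> \<not> (a \<le> i \<and> i < b)" if c: "cut_at i \<pi>"
  proof (intro allI impI notI)
    fix a b assume s: "subseq [b, a] \<pi>" and ab: "a \<le> i \<and> i < b"
    have "set (take i \<pi>) \<subseteq> {1..i}" using c p(2) split by (auto simp: cut_at_def)
    then have "set (take i \<pi>) = {1..i}" using card by (intro card_subset_eq) auto
    moreover have "a \<in> {1..i}" using ab subseq2D(2)[OF s p(1)] p(2) by auto
    ultimately have a: "a \<in> set (take i \<pi>)" by simp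
    have b: "b \<notin> set (take i \<pi>)" using c ab by (auto simp: cut_at_def)
    have "b \<in> set (drop i \<pi>)" using b subseq2D(1)[OF s p(1)] split by auto
    then have "subseq [a, b] (take i \<pi> @ drop i \<pi>)"
      using a subseq_append_iff[of "[a, b]"] subseq_singleton_left
      by (metis append_Cons append_Nil)
    then show False using s subseq2D(4)[of b a \<pi>] p(1) by simp
  qed
  show "cut_at i \<pi>" if c: "\<forall>a b. subseq [b, a] \<pi> \<longrightarrow> \<not> (a \<le> i \<and> i < b)"
  proof (rule ccontr)
    assume "\<not> cut_at i \<pi>"
    then obtain b where b: "b \<in> set (take i \<pi>)" "i < b" by (auto simp: cut_at_def not_le)
    have "\<not> {1..i} \<subseteq> set (take i \<pi>)"
      using card card_mono[of "set (take i \<pi>)" "insert b {1..i}"] b by auto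
    then obtain a where a: "a \<in> {1..i}" "a \<notin> set (take i \<pi>)" by blast
    then have "a \<in> set (drop i \<pi>)" using split p(2) assms(2) by auto
    then have "subseq [b, a] (take i \<pi> @ drop i \<pi>)"
      using b(1) subseq_append_iff[of "[b, a]"] subseq_singleton_left
      by (metis append_Cons append_Nil)
    then show False using c a b by auto
  qed
qed

lemma cut_length: "\<pi> \<in> perms n \<Longrightarrow> cut_at n \<pi>"
  using permsD by (fastforce simp: cut_at_def)

lemma cut_hd_le: "\<pi> \<in> perms n \<Longrightarrow> cut_at i \<pi> \<Longrightarrow> 1 \<le> i \<Longrightarrow> i \<le> n \<Longrightarrow> hd \<pi> \<le> i"
  using permsD(3)[of \<pi> n] by (cases \<pi>; cases i) (auto simp: cut_at_def)

lemma cut_last_gt: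
  assumes "\<pi> \<in> perms n" "cut_at i \<pi>" "i < n"
  shows "i < last \<pi>"
proof (rule ccontr)
  assume l: "\<not> i < last \<pi>"
  note p = permsD[OF assms(1)]
  have "subseq [n, last \<pi>] \<pi>" using p l assms(3) by (intro subseq_last) auto
  then show False using cut_iff_subseq[OF assms(1), of i] assms l by auto
qed

lemma cut_Suc_pre: "cut_at (Suc i) (prepend v \<pi>) \<longleftrightarrow> v \<le> Suc i \<and> cut_at i \<pi>"
proof -
  have "bump v x \<le> Suc i \<longleftrightarrow> x \<le> i" if "v \<le> Suc i" for x using that by (auto simp: bump_def)
  then show ?thesis by (auto simp: cut_at_def prepend_def take_map)
qed

lemma comp_stat_pre:
  assumes "\<pi> \<in> perms n"
  shows "comp_stat (prepend v \<pi>) = card {i \<in> {0..n}. v \<le> Suc i \<and> cut_at i \<pi>}"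
proof -
  have "{i \<in> {1..Suc n}. cut_at i (prepend v \<pi>)} = Suc ` {i \<in> {0..n}. v \<le> Suc i \<and> cut_at i \<pi>}"
    by (auto simp: cut_Suc_pre image_iff Bex_def gr0_conv_Suc Suc_le_eq)
  then show ?thesis using permsD(3)[OF assms] by (simp add: comp_stat_cut prepend_def card_image)
qed

text \<open>
  If \<open>v \<le> i\<close>, the last entry is one of the numbers up to \<open>i\<close>, so it would have to stand among the first
  \<open>i\<close> entries.
\<close>

lemma cut_app:
  assumes "postpend v \<pi> \<in> perms (Suc n)" "1 \<le> i" "i \<le> n"
  shows "cut_at i (postpend v \<pi>) \<longleftrightarrow> i < v \<and> cut_at i \<pi>"
proof (cases "i < v")
  case True
  have "length \<pi> = n" using permsD(3)[OF assms(1)] by (simp add: postpend_def)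
  moreover have "bump v x \<le> i \<longleftrightarrow> x \<le> i" for x using True by (auto simp: bump_def)
  ultimately show ?thesis using True assms(3) by (auto simp: cut_at_def postpend_def take_map)
next
  case False
  then show ?thesis using cut_last_gt[OF assms(1), of i] assms(3) by (auto simp: postpend_def)
qed

lemma comp_stat_app:
  assumes "\<pi> \<in> perms n" "v \<in> {1..Suc n}"
  shows "comp_stat (postpend v \<pi>) = Suc (card {i \<in> {1..n}. i < v \<and> cut_at i \<pi>})"
proof -
  have p: "postpend v \<pi> \<in> perms (Suc n)" using assms perms_Suc_app by blast
  have "{i \<in> {1..Suc n}. cut_at i (postpend v \<pi>)} = insert (Suc n) {i \<in> {1..n}. i < v \<and> cut_at i \<pi>}"
    using cut_app[OF p] cut_length[OF p] by (auto simp: le_Suc_eq)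
  then show ?thesis using permsD(3)[OF p] by (simp add: comp_stat_cut)
qed

section \<open>Active sites\<close>

text \<open>
  The predicate \<open>C\<close> is a simplified form of the condition on pairs. The entries are distinct, so only
  pairs with \<open>x \<noteq> y\<close> have to be considered when it is checked.
\<close>

lemma front_sites_iff:
  assumes "\<pi> \<in> avoiders n {[a, b, c], [d, e, f]}"
    and "\<And>x y. x \<noteq> y \<Longrightarrow> C x y \<longleftrightarrow> \<not> ((v \<le> x \<longleftrightarrow> a < b) \<and> (v \<le> y \<longleftrightarrow> a < c) \<and> (x < y \<longleftrightarrow> b < c)) \<and>
      \<not> ((v \<le> x \<longleftrightarrow> d < e) \<and> (v \<le> y \<longleftrightarrow> d < f) \<and> (x < y \<longleftrightarrow> e < f))"
  shows "v \<in> front_sites {[a, b, c], [d, e, f]} \<pi> \<longleftrightarrow>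
    1 \<le> v \<and> v \<le> Suc n \<and> (\<forall>x y. subseq [x, y] \<pi> \<longrightarrow> C x y)"
proof -
  have av: "\<not> contains \<pi> [a, b, c]" "\<not> contains \<pi> [d, e, f]" using assms(1) by (auto dest: avoidersD(2))
  have p: "length \<pi> = n" "distinct \<pi>" using avoidersD(1)[OF assms(1)] by (rule permsD)+
  have C: "C x y \<longleftrightarrow> \<not> ((v \<le> x \<longleftrightarrow> a < b) \<and> (v \<le> y \<longleftrightarrow> a < c) \<and> (x < y \<longleftrightarrow> b < c)) \<and>
      \<not> ((v \<le> x \<longleftrightarrow> d < e) \<and> (v \<le> y \<longleftrightarrow> d < f) \<and> (x < y \<longleftrightarrow> e < f))" if "subseq [x, y] \<pi>" for x y
    using subseq2D(3)[OF that p(2)] by (rule assms(2))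
  have "v \<in> front_sites {[a, b, c], [d, e, f]} \<pi> \<longleftrightarrow> 1 \<le> v \<and> v \<le> Suc n \<and>
      \<not> contains (prepend v \<pi>) [a, b, c] \<and> \<not> contains (prepend v \<pi>) [d, e, f]"
    unfolding front_sites_def p(1) by auto
  also have "\<not> contains (prepend v \<pi>) [a, b, c] \<and> \<not> contains (prepend v \<pi>) [d, e, f] \<longleftrightarrow>
      (\<forall>x y. subseq [x, y] \<pi> \<longrightarrow> C x y)"
    using av by (simp only: contains_prepend C simp_thms cong: imp_cong) blast
  finally show ?thesis .
qed

lemma back_sites_iff:
  assumes "\<pi> \<in> avoiders n {[a, b, c], [d, e, f]}"
    and "\<And>x y. x \<noteq> y \<Longrightarrow> C x y \<longleftrightarrow> \<not> ((x < y \<longleftrightarrow> a < b) \<and> (x < v \<longleftrightarrow> a < c) \<and> (y < v \<longleftrightarrow> b < c)) \<and>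
      \<not> ((x < y \<longleftrightarrow> d < e) \<and> (x < v \<longleftrightarrow> d < f) \<and> (y < v \<longleftrightarrow> e < f))"
  shows "v \<in> back_sites {[a, b, c], [d, e, f]} \<pi> \<longleftrightarrow>
    1 \<le> v \<and> v \<le> Suc n \<and> (\<forall>x y. subseq [x, y] \<pi> \<longrightarrow> C x y)"
proof -
  have av: "\<not> contains \<pi> [a, b, c]" "\<not> contains \<pi> [d, e, f]" using assms(1) by (auto dest: avoidersD(2))
  have p: "length \<pi> = n" "distinct \<pi>" using avoidersD(1)[OF assms(1)] by (rule permsD)+
  have C: "C x y \<longleftrightarrow> \<not> ((x < y \<longleftrightarrow> a < b) \<and> (x < v \<longleftrightarrow> a < c) \<and> (y < v \<longleftrightarrow> b < c)) \<and>
      \<not> ((x < y \<longleftrightarrow> d < e) \<and> (x < v \<longleftrightarrow> d < f) \<and> (y < v \<longleftrightarrow> e < f))" if "subseq [x, y] \<pi>" for x y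
    using subseq2D(3)[OF that p(2)] by (rule assms(2))
  have "v \<in> back_sites {[a, b, c], [d, e, f]} \<pi> \<longleftrightarrow> 1 \<le> v \<and> v \<le> Suc n \<and>
      \<not> contains (postpend v \<pi>) [a, b, c] \<and> \<not> contains (postpend v \<pi>) [d, e, f]"
    unfolding back_sites_def p(1) by auto
  also have "\<not> contains (postpend v \<pi>) [a, b, c] \<and> \<not> contains (postpend v \<pi>) [d, e, f] \<longleftrightarrow>
      (\<forall>x y. subseq [x, y] \<pi> \<longrightarrow> C x y)"
    using av by (simp only: contains_postpend C simp_thms cong: imp_cong) blast
  finally show ?thesis .
qed

text \<open>
  These two conditions decide, for the classes counted by \<open>1 + (n choose 2)\<close>, whether a second active
  site exists. They are used with the first or the last entry as threshold \<open>m\<close>.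
\<close>

definition no_rise_across :: "nat \<Rightarrow> nat list \<Rightarrow> bool" where
  "no_rise_across m \<pi> \<longleftrightarrow> (\<forall>a c. subseq [a, c] \<pi> \<longrightarrow> \<not> (a < m \<and> m < c))"

definition no_fall_across :: "nat \<Rightarrow> nat list \<Rightarrow> bool" where
  "no_fall_across m \<pi> \<longleftrightarrow> (\<forall>c a. subseq [c, a] \<pi> \<longrightarrow> \<not> (a < m \<and> m < c))"

lemma avoids3:
  assumes "\<pi> \<in> avoiders n P" "[a, b, c] \<in> P" "subseq [x, y, z] \<pi>"
  shows "\<not> ((x < y \<longleftrightarrow> a < b) \<and> (x < z \<longleftrightarrow> a < c) \<and> (y < z \<longleftrightarrow> b < c))"
  using avoidersD(2)[OF assms(1,2)] assms(3) unfolding contains3 by blast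

locale nonempty_perm =
  fixes \<pi> :: "nat list" and n :: nat
  assumes perm: "\<pi> \<in> perms n" and n: "1 \<le> n"
begin

lemma nonempty: "\<pi> \<noteq> []"
  using permsD(3)[OF perm] n by auto

lemma set: "set \<pi> = {1..n}"
  using permsD(2)[OF perm] .

lemma dist: "distinct \<pi>"
  using permsD(1)[OF perm] .

lemma len: "length \<pi> = n"
  using permsD(3)[OF perm] .

lemma hd_range: "1 \<le> hd \<pi>" "hd \<pi> \<le> n"
  using hd_in_set[OF nonempty] set by auto

lemma last_range: "1 \<le> last \<pi>" "last \<pi> \<le> n"
  using last_in_set[OF nonempty] set by auto

lemma sub_range: "subseq [x, y] \<pi> \<Longrightarrow> 1 \<le> x \<and> x \<le> n \<and> 1 \<le> y \<and> y \<le> n \<and> x \<noteq> y"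
  using subseq2D[of x y \<pi>] set dist by auto

lemma sub_total: "1 \<le> x \<Longrightarrow> x \<le> n \<Longrightarrow> 1 \<le> y \<Longrightarrow> y \<le> n \<Longrightarrow> x \<noteq> y \<Longrightarrow>
    subseq [x, y] \<pi> \<or> subseq [y, x] \<pi>"
  using subseq2_total[of x \<pi> y] set by simp

lemma sub_hd: "1 \<le> y \<Longrightarrow> y \<le> n \<Longrightarrow> y \<noteq> hd \<pi> \<Longrightarrow> subseq [hd \<pi>, y] \<pi>"
  using subseq_hd(1)[OF nonempty dist] set by simp

lemma sub_last: "1 \<le> y \<Longrightarrow> y \<le> n \<Longrightarrow> y \<noteq> last \<pi> \<Longrightarrow> subseq [y, last \<pi>] \<pi>"
  using subseq_last(1)[OF nonempty dist] set by simp

lemmas no_sub_hd = subseq_hd(2)[OF nonempty dist]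
lemmas no_sub_last = subseq_last(2)[OF nonempty dist]
lemmas sub3_hd = subseq_hd(3)[OF nonempty dist]
lemmas sub3_last = subseq_last(3)[OF nonempty dist]

end

lemma nonempty_perm_avoiders: "\<pi> \<in> avoiders n P \<Longrightarrow> 1 \<le> n \<Longrightarrow> nonempty_perm \<pi> n"
  unfolding nonempty_perm_def using avoidersD(1) by blast

text \<open>
  For the following six pairs the two patterns differ only in the order of the two entries other than
  the inserted one. A value \<open>v\<close> is then active if and only if no two entries lie on the forbidden sides
  of \<open>v\<close>, in whatever order they occur. For every other value
  than the two listed ones, two suitable entries refute it.
\<close>

lemma sites_213_231:
  assumes "\<pi> \<in> avoiders n {[2,1,3],[2,3,1]}" "1 \<le> n"
  shows "front_sites {[2,1,3],[2,3,1]} \<pi> = {1, Suc n}"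
proof -
  interpret nonempty_perm \<pi> n using assms by (rule nonempty_perm_avoiders)
  have sites: "v \<in> front_sites {[2,1,3],[2,3,1]} \<pi> \<longleftrightarrow> 1 \<le> v \<and> v \<le> Suc n \<and>
      (\<forall>y z. subseq [y, z] \<pi> \<longrightarrow> \<not> (y < v \<and> v \<le> z) \<and> \<not> (v \<le> y \<and> z < v))" for v
    by (rule front_sites_iff[OF assms(1)]) presburger
  show ?thesis
  proof (intro set_eqI iffI)
    fix v assume "v \<in> front_sites {[2,1,3],[2,3,1]} \<pi>"
    then have v: "1 \<le> v" "v \<le> Suc n" "\<And>y z. subseq [y, z] \<pi> \<Longrightarrow> \<not> (y < v \<and> v \<le> z) \<and> \<not> (v \<le> y \<and> z < v)"
      unfolding sites by blast+
    show "v \<in> {1, Suc n}"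
    proof (rule ccontr)
      assume "v \<notin> {1, Suc n}"
      then have "1 < v \<and> v \<le> n" using v(1,2) by auto
      then show False
        using sub_total[of 1 n] v(3)[of 1 n] v(3)[of n 1] v(1,2) n by auto
    qed
  next
    fix v assume "v \<in> {1, Suc n}"
    then show "v \<in> front_sites {[2,1,3],[2,3,1]} \<pi>" unfolding sites using n by (auto dest!: sub_range)
  qed
qed

lemma sites_132_312:
  assumes "\<pi> \<in> avoiders n {[1,3,2],[3,1,2]}" "1 \<le> n"
  shows "back_sites {[1,3,2],[3,1,2]} \<pi> = {1, Suc n}"
proof -
  interpret nonempty_perm \<pi> n using assms by (rule nonempty_perm_avoiders)
  have sites: "v \<in> back_sites {[1,3,2],[3,1,2]} \<pi> \<longleftrightarrow> 1 \<le> v \<and> v \<le> Suc n \<and>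
      (\<forall>y z. subseq [y, z] \<pi> \<longrightarrow> \<not> (y < v \<and> v \<le> z) \<and> \<not> (v \<le> y \<and> z < v))" for v
    by (rule back_sites_iff[OF assms(1)]) presburger
  show ?thesis
  proof (intro set_eqI iffI)
    fix v assume "v \<in> back_sites {[1,3,2],[3,1,2]} \<pi>"
    then have v: "1 \<le> v" "v \<le> Suc n" "\<And>y z. subseq [y, z] \<pi> \<Longrightarrow> \<not> (y < v \<and> v \<le> z) \<and> \<not> (v \<le> y \<and> z < v)"
      unfolding sites by blast+
    show "v \<in> {1, Suc n}"
    proof (rule ccontr)
      assume "v \<notin> {1, Suc n}"
      then have "1 < v \<and> v \<le> n" using v(1,2) by auto
      then show False
        using sub_total[of 1 n] v(3)[of 1 n] v(3)[of n 1] v(1,2) n by auto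
    qed
  next
    fix v assume "v \<in> {1, Suc n}"
    then show "v \<in> back_sites {[1,3,2],[3,1,2]} \<pi>" unfolding sites using n by (auto dest!: sub_range)
  qed
qed

lemma sites_312_321:
  assumes "\<pi> \<in> avoiders n {[3,1,2],[3,2,1]}" "1 \<le> n"
  shows "front_sites {[3,1,2],[3,2,1]} \<pi> = {1, 2}"
proof -
  interpret nonempty_perm \<pi> n using assms by (rule nonempty_perm_avoiders)
  have sites: "v \<in> front_sites {[3,1,2],[3,2,1]} \<pi> \<longleftrightarrow> 1 \<le> v \<and> v \<le> Suc n \<and>
      (\<forall>y z. subseq [y, z] \<pi> \<longrightarrow> \<not> (y < v \<and> z < v))" for v
    by (rule front_sites_iff[OF assms(1)]) presburger
  show ?thesis
  proof (intro set_eqI iffI)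
    fix v assume "v \<in> front_sites {[3,1,2],[3,2,1]} \<pi>"
    then have v: "1 \<le> v" "v \<le> Suc n" "\<And>y z. subseq [y, z] \<pi> \<Longrightarrow> \<not> (y < v \<and> z < v)"
      unfolding sites by blast+
    show "v \<in> {1, 2}"
    proof (rule ccontr)
      assume "v \<notin> {1, 2}"
      then have "2 < v" using v(1,2) by auto
      then show False
        using sub_total[of 1 2] v(3)[of 1 2] v(3)[of 2 1] v(1,2) n by auto
    qed
  next
    fix v :: nat assume "v \<in> {1, 2}"
    then show "v \<in> front_sites {[3,1,2],[3,2,1]} \<pi>" unfolding sites using n by (auto dest!: sub_range)
  qed
qed

lemma sites_123_213:
  assumes "\<pi> \<in> avoiders n {[1,2,3],[2,1,3]}" "1 \<le> n"
  shows "back_sites {[1,2,3],[2,1,3]} \<pi> = {1, 2}"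
proof -
  interpret nonempty_perm \<pi> n using assms by (rule nonempty_perm_avoiders)
  have sites: "v \<in> back_sites {[1,2,3],[2,1,3]} \<pi> \<longleftrightarrow> 1 \<le> v \<and> v \<le> Suc n \<and>
      (\<forall>y z. subseq [y, z] \<pi> \<longrightarrow> \<not> (y < v \<and> z < v))" for v
    by (rule back_sites_iff[OF assms(1)]) presburger
  show ?thesis
  proof (intro set_eqI iffI)
    fix v assume "v \<in> back_sites {[1,2,3],[2,1,3]} \<pi>"
    then have v: "1 \<le> v" "v \<le> Suc n" "\<And>y z. subseq [y, z] \<pi> \<Longrightarrow> \<not> (y < v \<and> z < v)"
      unfolding sites by blast+
    show "v \<in> {1, 2}"
    proof (rule ccontr)
      assume "v \<notin> {1, 2}"
      then have "2 < v" using v(1,2) by auto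
      then show False
        using sub_total[of 1 2] v(3)[of 1 2] v(3)[of 2 1] v(1,2) n by auto
    qed
  next
    fix v :: nat assume "v \<in> {1, 2}"
    then show "v \<in> back_sites {[1,2,3],[2,1,3]} \<pi>" unfolding sites using n by (auto dest!: sub_range)
  qed
qed

lemma sites_123_132:
  assumes "\<pi> \<in> avoiders n {[1,2,3],[1,3,2]}" "1 \<le> n"
  shows "front_sites {[1,2,3],[1,3,2]} \<pi> = {n, Suc n}"
proof -
  interpret nonempty_perm \<pi> n using assms by (rule nonempty_perm_avoiders)
  have sites: "v \<in> front_sites {[1,2,3],[1,3,2]} \<pi> \<longleftrightarrow> 1 \<le> v \<and> v \<le> Suc n \<and>
      (\<forall>y z. subseq [y, z] \<pi> \<longrightarrow> \<not> (v \<le> y \<and> v \<le> z))" for v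
    by (rule front_sites_iff[OF assms(1)]) presburger
  show ?thesis
  proof (intro set_eqI iffI)
    fix v assume "v \<in> front_sites {[1,2,3],[1,3,2]} \<pi>"
    then have v: "1 \<le> v" "v \<le> Suc n" "\<And>y z. subseq [y, z] \<pi> \<Longrightarrow> \<not> (v \<le> y \<and> v \<le> z)"
      unfolding sites by blast+
    show "v \<in> {n, Suc n}"
    proof (rule ccontr)
      assume "v \<notin> {n, Suc n}"
      then have "v < n" using v(1,2) by auto
      then show False
        using sub_total[of v n] v(3)[of v n] v(3)[of n v] v(1,2) n by auto
    qed
  next
    fix v assume "v \<in> {n, Suc n}"
    then show "v \<in> front_sites {[1,2,3],[1,3,2]} \<pi>" unfolding sites using n by (auto dest!: sub_range)
  qed
qed

lemma sites_231_321:
  assumes "\<pi> \<in> avoiders n {[2,3,1],[3,2,1]}" "1 \<le> n"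
  shows "back_sites {[2,3,1],[3,2,1]} \<pi> = {n, Suc n}"
proof -
  interpret nonempty_perm \<pi> n using assms by (rule nonempty_perm_avoiders)
  have sites: "v \<in> back_sites {[2,3,1],[3,2,1]} \<pi> \<longleftrightarrow> 1 \<le> v \<and> v \<le> Suc n \<and>
      (\<forall>y z. subseq [y, z] \<pi> \<longrightarrow> \<not> (v \<le> y \<and> v \<le> z))" for v
    by (rule back_sites_iff[OF assms(1)]) presburger
  show ?thesis
  proof (intro set_eqI iffI)
    fix v assume "v \<in> back_sites {[2,3,1],[3,2,1]} \<pi>"
    then have v: "1 \<le> v" "v \<le> Suc n" "\<And>y z. subseq [y, z] \<pi> \<Longrightarrow> \<not> (v \<le> y \<and> v \<le> z)"
      unfolding sites by blast+
    show "v \<in> {n, Suc n}"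
    proof (rule ccontr)
      assume "v \<notin> {n, Suc n}"
      then have "v < n" using v(1,2) by auto
      then show False
        using sub_total[of v n] v(3)[of v n] v(3)[of n v] v(1,2) n by auto
    qed
  next
    fix v assume "v \<in> {n, Suc n}"
    then show "v \<in> back_sites {[2,3,1],[3,2,1]} \<pi>" unfolding sites using n by (auto dest!: sub_range)
  qed
qed

text \<open>
  Values other than the two sites are refuted by the first entry together with \<open>1\<close> or with its
  successor. For \<open>v = hd \<pi> + 1\<close>, a pair \<open>y, z\<close> behind the first entry that completes \<open>v\<close> to an occurrence also
  completes \<open>hd \<pi>\<close> to one.
\<close>

lemma sites_231_312:
  assumes "\<pi> \<in> avoiders n {[2,3,1],[3,1,2]}" "1 \<le> n"
  shows "front_sites {[2,3,1],[3,1,2]} \<pi> = {1, Suc (hd \<pi>)}"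
proof -
  interpret nonempty_perm \<pi> n using assms by (rule nonempty_perm_avoiders)
  have sites: "v \<in> front_sites {[2,3,1],[3,1,2]} \<pi> \<longleftrightarrow> 1 \<le> v \<and> v \<le> Suc n \<and>
      (\<forall>y z. subseq [y, z] \<pi> \<longrightarrow> \<not> (v \<le> y \<and> z < v) \<and> \<not> (y < v \<and> z < v \<and> y < z))" for v
    by (rule front_sites_iff[OF assms(1)]) presburger
  show ?thesis
  proof (intro set_eqI iffI)
    fix v assume "v \<in> front_sites {[2,3,1],[3,1,2]} \<pi>"
    then have v: "1 \<le> v" "v \<le> Suc n" "\<And>y z. subseq [y, z] \<pi> \<Longrightarrow> \<not> (v \<le> y \<and> z < v) \<and> \<not> (y < v \<and> z < v \<and> y < z)"
      unfolding sites by blast+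
    show "v \<in> {1, Suc (hd \<pi>)}"
    proof (rule ccontr)
      assume neg: "v \<notin> {1, Suc (hd \<pi>)}"
      show False
      proof (cases "v \<le> hd \<pi>")
        case True
        then show False using sub_hd[of 1] v(3)[of "hd \<pi>" 1] v(1) neg n by auto
      next
        case False
        then show False
          using sub_hd[of "Suc (hd \<pi>)"] v(3)[of "hd \<pi>" "Suc (hd \<pi>)"] v(2) neg by auto
      qed
    qed
  next
    fix v assume "v \<in> {1, Suc (hd \<pi>)}"
    then show "v \<in> front_sites {[2,3,1],[3,1,2]} \<pi>"
    proof (elim insertE emptyE)
      assume "v = 1"
      then show ?thesis unfolding sites using n by (auto dest!: sub_range)
    next
      assume v: "v = Suc (hd \<pi>)"
      have "\<not> (v \<le> y \<and> z < v) \<and> \<not> (y < v \<and> z < v \<and> y < z)" if yz: "subseq [y, z] \<pi>" for y z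
      proof -
        have z: "z \<noteq> hd \<pi>" using yz no_sub_hd by auto
        show ?thesis
        proof (cases "y = hd \<pi>")
          case True
          then show ?thesis using z v by auto
        next
          case False
          then have "subseq [hd \<pi>, y, z] \<pi>" using sub3_hd yz by blast
          from avoids3[OF assms(1) _ this, of 2 3 1] avoids3[OF assms(1) _ this, of 3 1 2]
          show ?thesis using z v False by auto
        qed
      qed
      then show ?thesis unfolding sites using v hd_range by auto
    qed
  qed
qed

text \<open>
  As for \<open>sites_231_312\<close>: an occurrence that uses \<open>v = hd \<pi>\<close> can use the old first entry instead.
\<close>

lemma sites_132_213:
  assumes "\<pi> \<in> avoiders n {[1,3,2],[2,1,3]}" "1 \<le> n"
  shows "front_sites {[1,3,2],[2,1,3]} \<pi> = {hd \<pi>, Suc n}"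
proof -
  interpret nonempty_perm \<pi> n using assms by (rule nonempty_perm_avoiders)
  have sites: "v \<in> front_sites {[1,3,2],[2,1,3]} \<pi> \<longleftrightarrow> 1 \<le> v \<and> v \<le> Suc n \<and>
      (\<forall>y z. subseq [y, z] \<pi> \<longrightarrow> \<not> (v \<le> y \<and> v \<le> z \<and> z < y) \<and> \<not> (y < v \<and> v \<le> z))" for v
    by (rule front_sites_iff[OF assms(1)]) presburger
  show ?thesis
  proof (intro set_eqI iffI)
    fix v assume "v \<in> front_sites {[1,3,2],[2,1,3]} \<pi>"
    then have v: "1 \<le> v" "v \<le> Suc n" "\<And>y z. subseq [y, z] \<pi> \<Longrightarrow> \<not> (v \<le> y \<and> v \<le> z \<and> z < y) \<and> \<not> (y < v \<and> v \<le> z)"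
      unfolding sites by blast+
    show "v \<in> {hd \<pi>, Suc n}"
    proof (rule ccontr)
      assume neg: "v \<notin> {hd \<pi>, Suc n}"
      show False
      proof (cases "v < hd \<pi>")
        case True
        then show False using sub_hd[of v] v(3)[of "hd \<pi>" v] v(1,2) neg by auto
      next
        case False
        then show False
          using sub_hd[of n] v(3)[of "hd \<pi>" n] v(2) neg n by auto
      qed
    qed
  next
    fix v assume "v \<in> {hd \<pi>, Suc n}"
    then show "v \<in> front_sites {[1,3,2],[2,1,3]} \<pi>"
    proof (elim insertE emptyE)
      assume "v = Suc n"
      then show ?thesis unfolding sites using n by (auto dest!: sub_range)
    next
      assume v: "v = hd \<pi>"
      have "\<not> (v \<le> y \<and> v \<le> z \<and> z < y) \<and> \<not> (y < v \<and> v \<le> z)" if yz: "subseq [y, z] \<pi>" for y z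
      proof -
        have z: "z \<noteq> hd \<pi>" using yz no_sub_hd by auto
        show ?thesis
        proof (cases "y = hd \<pi>")
          case True
          then show ?thesis using z v by auto
        next
          case False
          then have "subseq [hd \<pi>, y, z] \<pi>" using sub3_hd yz by blast
          from avoids3[OF assms(1) _ this, of 1 3 2] avoids3[OF assms(1) _ this, of 2 1 3]
          show ?thesis using z v False by auto
        qed
      qed
      then show ?thesis unfolding sites using v hd_range by auto
    qed
  qed
qed

text \<open>
  The next four classes have one site that is always active and a second one, determined by the
  first or the last entry, that is active only under a condition. One of the two patterns cannot
  arise there, by the same replacement argument; the other one is excluded exactly by the condition.
\<close>

lemma sites_132_321:
  assumes "\<pi> \<in> avoiders n {[1,3,2],[3,2,1]}" "1 \<le> n"
  shows "back_sites {[1,3,2],[3,2,1]} \<pi> = insert (Suc n)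
    (if no_rise_across (hd \<pi>) \<pi> then {hd \<pi>} else {})"
proof -
  interpret nonempty_perm \<pi> n using assms by (rule nonempty_perm_avoiders)
  have sites: "v \<in> back_sites {[1,3,2],[3,2,1]} \<pi> \<longleftrightarrow> 1 \<le> v \<and> v \<le> Suc n \<and>
      (\<forall>y z. subseq [y, z] \<pi> \<longrightarrow> \<not> (y < v \<and> v \<le> z) \<and> \<not> (z < y \<and> v \<le> y \<and> v \<le> z))" for v
    by (rule back_sites_iff[OF assms(1)]) presburger
  have max: "Suc n \<in> back_sites {[1,3,2],[3,2,1]} \<pi>"
    unfolding sites by (auto dest!: sub_range)
  have other: "v = hd \<pi>" if "v \<in> back_sites {[1,3,2],[3,2,1]} \<pi>" "v \<noteq> Suc n" for v
  proof (rule ccontr)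
    assume neg: "v \<noteq> hd \<pi>"
    have v: "1 \<le> v" "v \<le> n" "\<And>y z. subseq [y, z] \<pi> \<Longrightarrow> \<not> (y < v \<and> v \<le> z) \<and> \<not> (z < y \<and> v \<le> y \<and> v \<le> z)"
      using that unfolding sites by (simp_all add: le_Suc_eq)
    show False
    proof (cases "v < hd \<pi>")
      case True
      then show False using sub_hd[of v] v(3)[of "hd \<pi>" v] v(1,2) by auto
    next
      case False
      then show False using sub_hd[of n] v(3)[of "hd \<pi>" n] v(2) neg n by auto
    qed
  qed
  have "hd \<pi> \<in> back_sites {[1,3,2],[3,2,1]} \<pi> \<longleftrightarrow>
      (\<forall>a c. subseq [a, c] \<pi> \<longrightarrow> \<not> (a < hd \<pi> \<and> hd \<pi> < c))" (is "?L \<longleftrightarrow> ?R")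
  proof
    assume ?L
    then show ?R unfolding sites by (meson less_imp_le)
  next
    assume R: ?R
    have "\<not> (y < hd \<pi> \<and> hd \<pi> \<le> z) \<and> \<not> (z < y \<and> hd \<pi> \<le> y \<and> hd \<pi> \<le> z)" if yz: "subseq [y, z] \<pi>" for y z
    proof -
      have z: "z \<noteq> hd \<pi>" using yz no_sub_hd by auto
      show ?thesis
      proof (cases "y = hd \<pi>")
        case False
        then have "subseq [hd \<pi>, y, z] \<pi>" using sub3_hd yz by blast
        from avoids3[OF assms(1) _ this, of 1 3 2]
        show ?thesis using R[rule_format, OF yz] z False by auto
      qed (use z in auto)
    qed
    then show ?L unfolding sites using hd_range by auto
  qed
  with max other show ?thesis by (auto simp: no_rise_across_def no_fall_across_def)
qed

lemma sites_123_312: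
  assumes "\<pi> \<in> avoiders n {[1,2,3],[3,1,2]}" "1 \<le> n"
  shows "back_sites {[1,2,3],[3,1,2]} \<pi> = insert 1
    (if no_fall_across (hd \<pi>) \<pi> then {Suc (hd \<pi>)} else {})"
proof -
  interpret nonempty_perm \<pi> n using assms by (rule nonempty_perm_avoiders)
  have sites: "v \<in> back_sites {[1,2,3],[3,1,2]} \<pi> \<longleftrightarrow> 1 \<le> v \<and> v \<le> Suc n \<and>
      (\<forall>y z. subseq [y, z] \<pi> \<longrightarrow> \<not> (v \<le> y \<and> z < v) \<and> \<not> (y < z \<and> y < v \<and> z < v))" for v
    by (rule back_sites_iff[OF assms(1)]) presburger
  have one: "1 \<in> back_sites {[1,2,3],[3,1,2]} \<pi>"
    unfolding sites by (auto dest!: sub_range)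
  have other: "v = Suc (hd \<pi>)" if "v \<in> back_sites {[1,2,3],[3,1,2]} \<pi>" "v \<noteq> 1" for v
  proof (rule ccontr)
    assume neg: "v \<noteq> Suc (hd \<pi>)"
    have v: "1 < v" "v \<le> Suc n" "\<And>y z. subseq [y, z] \<pi> \<Longrightarrow> \<not> (v \<le> y \<and> z < v) \<and> \<not> (y < z \<and> y < v \<and> z < v)"
      using that unfolding sites by simp_all
    show False
    proof (cases "v \<le> hd \<pi>")
      case True
      then show False using sub_hd[of 1] v(3)[of "hd \<pi>" 1] v(1) n by auto
    next
      case False
      then show False using sub_hd[of "Suc (hd \<pi>)"] v(3)[of "hd \<pi>" "Suc (hd \<pi>)"] v(2) neg by auto
    qed
  qed
  have "Suc (hd \<pi>) \<in> back_sites {[1,2,3],[3,1,2]} \<pi> \<longleftrightarrow>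
      (\<forall>c a. subseq [c, a] \<pi> \<longrightarrow> \<not> (a < hd \<pi> \<and> hd \<pi> < c))" (is "?L \<longleftrightarrow> ?R")
  proof
    assume ?L
    then show ?R unfolding sites by (meson Suc_leI less_Suc_eq)
  next
    assume R: ?R
    have "\<not> (Suc (hd \<pi>) \<le> y \<and> z < Suc (hd \<pi>)) \<and> \<not> (y < z \<and> y < Suc (hd \<pi>) \<and> z < Suc (hd \<pi>))"
      if yz: "subseq [y, z] \<pi>" for y z
    proof -
      have z: "z \<noteq> hd \<pi>" using yz no_sub_hd by auto
      show ?thesis
      proof (cases "y = hd \<pi>")
        case False
        then have "subseq [hd \<pi>, y, z] \<pi>" using sub3_hd yz by blast
        from avoids3[OF assms(1) _ this, of 3 1 2]
        show ?thesis using R[rule_format, OF yz] z False by auto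
      qed (use z in auto)
    qed
    then show ?L unfolding sites using hd_range by auto
  qed
  with one other show ?thesis by (auto simp: no_rise_across_def no_fall_across_def)
qed

lemma sites_213_321:
  assumes "\<pi> \<in> avoiders n {[2,1,3],[3,2,1]}" "1 \<le> n"
  shows "front_sites {[2,1,3],[3,2,1]} \<pi> = insert 1
    (if no_rise_across (last \<pi>) \<pi> then {Suc (last \<pi>)} else {})"
proof -
  interpret nonempty_perm \<pi> n using assms by (rule nonempty_perm_avoiders)
  have sites: "v \<in> front_sites {[2,1,3],[3,2,1]} \<pi> \<longleftrightarrow> 1 \<le> v \<and> v \<le> Suc n \<and>
      (\<forall>y z. subseq [y, z] \<pi> \<longrightarrow> \<not> (y < v \<and> v \<le> z) \<and> \<not> (z < y \<and> y < v \<and> z < v))" for v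
    by (rule front_sites_iff[OF assms(1)]) presburger
  have one: "1 \<in> front_sites {[2,1,3],[3,2,1]} \<pi>"
    unfolding sites by (auto dest!: sub_range)
  have other: "v = Suc (last \<pi>)" if "v \<in> front_sites {[2,1,3],[3,2,1]} \<pi>" "v \<noteq> 1" for v
  proof (rule ccontr)
    assume neg: "v \<noteq> Suc (last \<pi>)"
    have v: "1 < v" "v \<le> Suc n" "\<And>y z. subseq [y, z] \<pi> \<Longrightarrow> \<not> (y < v \<and> v \<le> z) \<and> \<not> (z < y \<and> y < v \<and> z < v)"
      using that unfolding sites by simp_all
    show False
    proof (cases "v \<le> last \<pi>")
      case True
      then show False using sub_last[of 1] v(3)[of 1 "last \<pi>"] v(1) n by auto
    next
      case False
      then show False using sub_last[of "Suc (last \<pi>)"] v(3)[of "Suc (last \<pi>)" "last \<pi>"] v(2) neg by auto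
    qed
  qed
  have "Suc (last \<pi>) \<in> front_sites {[2,1,3],[3,2,1]} \<pi> \<longleftrightarrow>
      (\<forall>a c. subseq [a, c] \<pi> \<longrightarrow> \<not> (a < last \<pi> \<and> last \<pi> < c))" (is "?L \<longleftrightarrow> ?R")
  proof
    assume ?L
    then show ?R unfolding sites by (meson Suc_leI less_Suc_eq)
  next
    assume R: ?R
    have "\<not> (y < Suc (last \<pi>) \<and> Suc (last \<pi>) \<le> z) \<and> \<not> (z < y \<and> y < Suc (last \<pi>) \<and> z < Suc (last \<pi>))"
      if yz: "subseq [y, z] \<pi>" for y z
    proof -
      have y: "y \<noteq> last \<pi>" using yz no_sub_last by auto
      show ?thesis
      proof (cases "z = last \<pi>")
        case False
        then have "subseq [y, z, last \<pi>] \<pi>" using sub3_last yz by blast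
        from avoids3[OF assms(1) _ this, of 2 1 3]
        show ?thesis using R[rule_format, OF yz] y False by auto
      qed (use y in auto)
    qed
    then show ?L unfolding sites using last_range by auto
  qed
  with one other show ?thesis by (auto simp: no_rise_across_def no_fall_across_def)
qed

lemma sites_123_231:
  assumes "\<pi> \<in> avoiders n {[1,2,3],[2,3,1]}" "1 \<le> n"
  shows "front_sites {[1,2,3],[2,3,1]} \<pi> = insert (Suc n)
    (if no_fall_across (last \<pi>) \<pi> then {last \<pi>} else {})"
proof -
  interpret nonempty_perm \<pi> n using assms by (rule nonempty_perm_avoiders)
  have sites: "v \<in> front_sites {[1,2,3],[2,3,1]} \<pi> \<longleftrightarrow> 1 \<le> v \<and> v \<le> Suc n \<and>
      (\<forall>y z. subseq [y, z] \<pi> \<longrightarrow> \<not> (v \<le> y \<and> z < v) \<and> \<not> (y < z \<and> v \<le> y \<and> v \<le> z))" for v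
    by (rule front_sites_iff[OF assms(1)]) presburger
  have max: "Suc n \<in> front_sites {[1,2,3],[2,3,1]} \<pi>"
    unfolding sites by (auto dest!: sub_range)
  have other: "v = last \<pi>" if "v \<in> front_sites {[1,2,3],[2,3,1]} \<pi>" "v \<noteq> Suc n" for v
  proof (rule ccontr)
    assume neg: "v \<noteq> last \<pi>"
    have v: "1 \<le> v" "v \<le> n" "\<And>y z. subseq [y, z] \<pi> \<Longrightarrow> \<not> (v \<le> y \<and> z < v) \<and> \<not> (y < z \<and> v \<le> y \<and> v \<le> z)"
      using that unfolding sites by (simp_all add: le_Suc_eq)
    show False
    proof (cases "v < last \<pi>")
      case True
      then show False using sub_last[of v] v(3)[of v "last \<pi>"] v(1,2) by auto
    next
      case False
      then show False using sub_last[of n] v(3)[of n "last \<pi>"] v(2) neg n by auto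
    qed
  qed
  have "last \<pi> \<in> front_sites {[1,2,3],[2,3,1]} \<pi> \<longleftrightarrow>
      (\<forall>c a. subseq [c, a] \<pi> \<longrightarrow> \<not> (a < last \<pi> \<and> last \<pi> < c))" (is "?L \<longleftrightarrow> ?R")
  proof
    assume ?L
    then show ?R unfolding sites by (meson less_imp_le)
  next
    assume R: ?R
    have "\<not> (last \<pi> \<le> y \<and> z < last \<pi>) \<and> \<not> (y < z \<and> last \<pi> \<le> y \<and> last \<pi> \<le> z)" if yz: "subseq [y, z] \<pi>" for y z
    proof -
      have y: "y \<noteq> last \<pi>" using yz no_sub_last by auto
      show ?thesis
      proof (cases "z = last \<pi>")
        case False
        then have "subseq [y, z, last \<pi>] \<pi>" using sub3_last yz by blast
        from avoids3[OF assms(1) _ this, of 2 3 1]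
        show ?thesis using R[rule_format, OF yz] y False by auto
      qed (use y in auto)
    qed
    then show ?L unfolding sites using last_range by auto
  qed
  with max other show ?thesis by (auto simp: no_rise_across_def no_fall_across_def)
qed

section \<open>Succession rules\<close>

text \<open>
  The first four rules produce two children at every node. Here one child prolongs the statistic and
  the other one starts again.
\<close>

definition rule_reset :: "nat \<Rightarrow> nat \<Rightarrow> nat multiset" where
  "rule_reset n k = {#Suc k, 1#}"

text \<open>
  Only the full value \<open>k = n\<close>, attained by the increasing permutation alone, is ever changed.
\<close>

definition rule_split :: "nat \<Rightarrow> nat \<Rightarrow> nat multiset" where
  "rule_split n k = (if k = n then {#Suc n, n#} else {#k, k#})"

definition rule_stay :: "nat \<Rightarrow> nat \<Rightarrow> nat multiset" where
  "rule_stay n k = {#Suc k, k#}"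

text \<open>
  The bit says that the permutation ends with its maximum (or begins with 1). It decides whether the
  second child has two components.
\<close>

fun rule_few :: "nat \<Rightarrow> nat \<times> bool \<Rightarrow> (nat \<times> bool) multiset" where
  "rule_few n (c, b) = {#(1, False), (if b then 2 else 1, b)#}"

text \<open>
  The first bit \<open>a\<close> marks the single monotone permutation of each length (its first or last entry is
  the extreme one that forces monotonicity in the class at hand). The second bit \<open>x\<close> says that the
  second site is active.
\<close>

fun rule_rise :: "nat \<Rightarrow> nat \<times> bool \<times> bool \<Rightarrow> (nat \<times> bool \<times> bool) multiset" where
  "rule_rise n (c, a, x) = add_mset (Suc c, a, a) (if x then {#(1, False, True)#} else {#})"

fun rule_fall :: "nat \<Rightarrow> nat \<times> bool \<times> bool \<Rightarrow> (nat \<times> bool \<times> bool) multiset" where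
  "rule_fall n (c, a, x) = add_mset (1, a, a) (if x then {#(2, False, True)#} else {#})"

text \<open>
  What remains of \<open>rule_rise\<close> and of \<open>rule_fall\<close> when the component count is forgotten.
\<close>

fun rule_binom :: "nat \<Rightarrow> bool \<times> bool \<Rightarrow> (bool \<times> bool) multiset" where
  "rule_binom n (a, x) = add_mset (a, a) (if x then {#(False, True)#} else {#})"

lemma subseq2_app: "subseq [x, y] (postpend v \<pi>) \<longleftrightarrow>
    (\<exists>x' y'. subseq [x', y'] \<pi> \<and> x = bump v x' \<and> y = bump v y') \<or> (\<exists>x'\<in>set \<pi>. x = bump v x' \<and> y = v)"
  unfolding postpend_def subseq_snoc2 subseq2_map by auto

lemma subseq2_pre: "subseq [x, y] (prepend v \<pi>) \<longleftrightarrow>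
    (\<exists>x' y'. subseq [x', y'] \<pi> \<and> x = bump v x' \<and> y = bump v y') \<or> (x = v \<and> (\<exists>y'\<in>set \<pi>. y = bump v y'))"
proof -
  have "subseq [x, y] (prepend v \<pi>) \<longleftrightarrow>
      subseq [x, y] (map (bump v) \<pi>) \<or> (x = v \<and> y \<in> set (map (bump v) \<pi>))"
    using subseq_Cons'[of x "[y]" "map (bump v) \<pi>"] unfolding prepend_def subseq_Cons2_iff subseq_singleton_left by auto
  then show ?thesis unfolding subseq2_map by auto
qed

lemma all_subseq2_app: "(\<forall>x y. subseq [x, y] (postpend v \<pi>) \<longrightarrow> R x y) \<longleftrightarrow>
    (\<forall>x y. subseq [x, y] \<pi> \<longrightarrow> R (bump v x) (bump v y)) \<and> (\<forall>x\<in>set \<pi>. R (bump v x) v)"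
  unfolding subseq2_app by blast

lemma all_subseq2_pre: "(\<forall>x y. subseq [x, y] (prepend v \<pi>) \<longrightarrow> R x y) \<longleftrightarrow>
    (\<forall>x y. subseq [x, y] \<pi> \<longrightarrow> R (bump v x) (bump v y)) \<and> (\<forall>y\<in>set \<pi>. R v (bump v y))"
  unfolding subseq2_pre by blast

lemma no_rise_across_app: "no_rise_across (bump v m) (postpend v \<pi>) \<longleftrightarrow>
    no_rise_across m \<pi> \<and> (\<forall>a\<in>set \<pi>. \<not> (a < m \<and> m < v))"
  unfolding no_rise_across_def all_subseq2_app bump_less bump_less_self by blast

lemma no_fall_across_app: "no_fall_across (bump v m) (postpend v \<pi>) \<longleftrightarrow>
    no_fall_across m \<pi> \<and> (\<forall>c\<in>set \<pi>. \<not> (v \<le> m \<and> m < c))"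
  unfolding no_fall_across_def all_subseq2_app bump_less bump_less_self by blast

lemma no_rise_across_pre: "no_rise_across (bump v m) (prepend v \<pi>) \<longleftrightarrow>
    no_rise_across m \<pi> \<and> (\<forall>c\<in>set \<pi>. \<not> (v \<le> m \<and> m < c))"
  unfolding no_rise_across_def all_subseq2_pre bump_less bump_less_self by blast

lemma no_fall_across_pre: "no_fall_across (bump v m) (prepend v \<pi>) \<longleftrightarrow>
    no_fall_across m \<pi> \<and> (\<forall>a\<in>set \<pi>. \<not> (a < m \<and> m < v))"
  unfolding no_fall_across_def all_subseq2_pre bump_less bump_less_self by blast

lemma hd_app: "\<pi> \<noteq> [] \<Longrightarrow> hd (postpend v \<pi>) = bump v (hd \<pi>)"
  by (simp add: postpend_def hd_map)

lemma last_pre: "\<pi> \<noteq> [] \<Longrightarrow> last (prepend v \<pi>) = bump v (last \<pi>)"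
  by (simp add: prepend_def last_map)

lemma length_app [simp]: "length (postpend v \<pi>) = Suc (length \<pi>)"
  by (simp add: postpend_def)

lemma length_pre [simp]: "length (prepend v \<pi>) = Suc (length \<pi>)"
  by (simp add: prepend_def)

context nonempty_perm
begin

lemma comp_eq: "comp_stat \<pi> = card {i \<in> {1..n}. cut_at i \<pi>}"
  by (simp add: comp_stat_cut len)

lemma comp_pre_1: "comp_stat (prepend 1 \<pi>) = Suc (comp_stat \<pi>)"
proof -
  have "{i \<in> {0..n}. 1 \<le> Suc i \<and> cut_at i \<pi>} = insert 0 {i \<in> {1..n}. cut_at i \<pi>}"
    by (auto simp: cut_at_def Suc_le_eq intro!: gr0I)
  then show ?thesis
    by (simp only: comp_stat_pre[OF perm] comp_eq) (rule card_insert_disjoint, auto)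
qed

lemma comp_pre_max: "comp_stat (prepend (Suc n) \<pi>) = 1"
proof -
  have "{i \<in> {0..n}. Suc n \<le> Suc i \<and> cut_at i \<pi>} = {n}"
    using cut_length[OF perm] by auto
  then show ?thesis by (simp only: comp_stat_pre[OF perm]) simp
qed

lemma comp_pre_2: "comp_stat (prepend 2 \<pi>) = comp_stat \<pi>"
proof -
  have "{i \<in> {0..n}. 2 \<le> Suc i \<and> cut_at i \<pi>} = {i \<in> {1..n}. cut_at i \<pi>}" by auto
  then show ?thesis by (simp only: comp_stat_pre[OF perm] comp_eq)
qed

lemma comp_pre_Suc_hd: "comp_stat (prepend (Suc (hd \<pi>)) \<pi>) = comp_stat \<pi>"
proof -
  have "{i \<in> {0..n}. Suc (hd \<pi>) \<le> Suc i \<and> cut_at i \<pi>} = {i \<in> {1..n}. cut_at i \<pi>}"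
    using cut_hd_le[OF perm] hd_range by auto
  then show ?thesis by (simp only: comp_stat_pre[OF perm] comp_eq)
qed

lemma comp_pre_Suc_last: "comp_stat (prepend (Suc (last \<pi>)) \<pi>) = 1"
proof -
  have "i = n" if "last \<pi> \<le> i" "i \<le> n" "cut_at i \<pi>" for i
    using cut_last_gt[OF perm that(3)] that by (cases "i = n") auto
  then have "{i \<in> {0..n}. Suc (last \<pi>) \<le> Suc i \<and> cut_at i \<pi>} = {n}"
    using cut_length[OF perm] last_range by auto
  then show ?thesis by (simp only: comp_stat_pre[OF perm]) simp
qed

lemma comp_pre_n: "comp_stat (prepend n \<pi>) = (if last \<pi> = n then 2 else 1)"
proof -
  have "cut_at (n - 1) \<pi> \<longleftrightarrow> last \<pi> = n"
  proof
    assume "cut_at (n - 1) \<pi>"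
    then have "n - 1 < last \<pi>" using n by (intro cut_last_gt[OF perm]) auto
    then show "last \<pi> = n" using last_range by simp
  next
    assume l: "last \<pi> = n"
    have "\<not> (a \<le> n - 1 \<and> n - 1 < b)" if "subseq [b, a] \<pi>" for a b
      using that sub_range[OF that] no_sub_last l by (cases "b = n") auto
    then show "cut_at (n - 1) \<pi>" by (subst cut_iff_subseq[OF perm]) auto
  qed
  then have "{i \<in> {0..n}. n \<le> Suc i \<and> cut_at i \<pi>} = (if last \<pi> = n then {n - 1, n} else {n})"
    using cut_length[OF perm] n by (auto simp: le_Suc_eq)
  then show ?thesis using n by (simp add: comp_stat_pre[OF perm] card_insert_if)
qed

lemma comp_pre_last:
  assumes "no_fall_across (last \<pi>) \<pi>"
  shows "comp_stat (prepend (last \<pi>) \<pi>) = 2"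
proof -
  have "\<not> (a \<le> last \<pi> - 1 \<and> last \<pi> - 1 < b)" if s: "subseq [b, a] \<pi>" for a b
  proof -
    have "b \<noteq> last \<pi>" using s no_sub_last by blast
    then show ?thesis using assms s last_range unfolding no_fall_across_def by fastforce
  qed
  then have "cut_at (last \<pi> - 1) \<pi>"
    using last_range by (subst cut_iff_subseq[OF perm]) auto
  moreover have "i = n" if "last \<pi> \<le> i" "i \<le> n" "cut_at i \<pi>" for i
    using cut_last_gt[OF perm that(3)] that by (cases "i = n") auto
  ultimately have "{i \<in> {0..n}. last \<pi> \<le> Suc i \<and> cut_at i \<pi>} = {last \<pi> - 1, n}"
    using cut_length[OF perm] last_range by (auto simp: le_Suc_eq)
  moreover have "last \<pi> - 1 \<noteq> n" using last_range by simp
  ultimately show ?thesis by (simp add: comp_stat_pre[OF perm])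
qed

lemma comp_app_1: "comp_stat (postpend 1 \<pi>) = 1"
proof -
  have "{i \<in> {1..n}. i < 1 \<and> cut_at i \<pi>} = {}" by auto
  then show ?thesis using comp_stat_app[OF perm, of 1] by simp
qed

lemma comp_app_max: "comp_stat (postpend (Suc n) \<pi>) = Suc (comp_stat \<pi>)"
proof -
  have "{i \<in> {1..n}. i < Suc n \<and> cut_at i \<pi>} = {i \<in> {1..n}. cut_at i \<pi>}" by auto
  then show ?thesis using comp_stat_app[OF perm, of "Suc n"] by (simp add: comp_eq)
qed

lemma comp_app_n: "comp_stat (postpend n \<pi>) = comp_stat \<pi>"
proof -
  have "{i \<in> {1..n}. cut_at i \<pi>} = insert n {i \<in> {1..n}. i < n \<and> cut_at i \<pi>}"
    using cut_length[OF perm] n by auto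
  then show ?thesis using comp_stat_app[OF perm, of n] n by (simp add: comp_eq)
qed

lemma comp_app_2: "comp_stat (postpend 2 \<pi>) = (if hd \<pi> = 1 then 2 else 1)"
proof -
  have "cut_at 1 \<pi> \<longleftrightarrow> hd \<pi> = 1"
    using cut_hd_le[OF perm, of 1] hd_range n nonempty by (cases \<pi>) (auto simp: cut_at_def)
  then have "{i \<in> {1..n}. i < 2 \<and> cut_at i \<pi>} = (if hd \<pi> = 1 then {1} else {})"
    using n by (auto simp: less_2_cases_iff)
  then show ?thesis using comp_stat_app[OF perm, of 2] n by simp
qed

lemma comp_app_hd: "comp_stat (postpend (hd \<pi>) \<pi>) = 1"
proof -
  have "{i \<in> {1..n}. i < hd \<pi> \<and> cut_at i \<pi>} = {}"
    using cut_hd_le[OF perm] by (auto simp: not_le[symmetric])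
  then show ?thesis using comp_stat_app[OF perm, of "hd \<pi>"] hd_range by simp
qed

lemma comp_app_Suc_hd:
  assumes "no_fall_across (hd \<pi>) \<pi>"
  shows "comp_stat (postpend (Suc (hd \<pi>)) \<pi>) = 2"
proof -
  have "\<not> (a \<le> hd \<pi> \<and> hd \<pi> < b)" if s: "subseq [b, a] \<pi>" for a b
  proof -
    have "a \<noteq> hd \<pi>" using s no_sub_hd by blast
    then show ?thesis using assms s unfolding no_fall_across_def by fastforce
  qed
  then have "cut_at (hd \<pi>) \<pi>"
    using hd_range by (subst cut_iff_subseq[OF perm]) auto
  moreover have "hd \<pi> \<le> i" if "1 \<le> i" "i \<le> n" "cut_at i \<pi>" for i
    using cut_hd_le[OF perm] that by blast
  ultimately have "{i \<in> {1..n}. i < Suc (hd \<pi>) \<and> cut_at i \<pi>} = {hd \<pi>}"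
    using hd_range by (auto simp: less_Suc_eq_le intro: antisym)
  then show ?thesis using comp_stat_app[OF perm, of "Suc (hd \<pi>)"] hd_range by simp
qed

lemma no_rise_hd_1: "hd \<pi> = 1 \<Longrightarrow> no_rise_across (hd \<pi>) \<pi>"
  and no_fall_last_1: "last \<pi> = 1 \<Longrightarrow> no_fall_across (last \<pi>) \<pi>"
  and no_rise_last_n: "last \<pi> = n \<Longrightarrow> no_rise_across (last \<pi>) \<pi>"
  and no_fall_hd_n: "hd \<pi> = n \<Longrightarrow> no_fall_across (hd \<pi>) \<pi>"
  unfolding no_rise_across_def no_fall_across_def using sub_range by fastforce+

end

lemma follows_iar_213_231: "follows (front_children {[2,1,3],[2,3,1]}) {[2,1,3],[2,3,1]} iar rule_reset"
proof (rule follows_frontI)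
  fix n \<pi> assume a: "1 \<le> n" "\<pi> \<in> avoiders n {[2,1,3],[2,3,1]}"
  interpret nonempty_perm \<pi> n using a(2,1) by (rule nonempty_perm_avoiders)
  show "image_mset (\<lambda>v. iar (prepend v \<pi>)) (mset_set (front_sites {[2,1,3],[2,3,1]} \<pi>)) = rule_reset n (iar \<pi>)"
    unfolding sites_213_231[OF a(2,1)] using n hd_range by (simp add: iar_pre nonempty rule_reset_def)
qed

lemma follows_comp_213_231: "follows (front_children {[2,1,3],[2,3,1]}) {[2,1,3],[2,3,1]} comp_stat rule_reset"
proof (rule follows_frontI)
  fix n \<pi> assume a: "1 \<le> n" "\<pi> \<in> avoiders n {[2,1,3],[2,3,1]}"
  interpret nonempty_perm \<pi> n using a(2,1) by (rule nonempty_perm_avoiders)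
  show "image_mset (\<lambda>v. comp_stat (prepend v \<pi>)) (mset_set (front_sites {[2,1,3],[2,3,1]} \<pi>)) = rule_reset n (comp_stat \<pi>)"
    unfolding sites_213_231[OF a(2,1)] using n by (simp add: comp_pre_1[simplified] comp_pre_max rule_reset_def)
qed

lemma follows_iar_132_213: "follows (front_children {[1,3,2],[2,1,3]}) {[1,3,2],[2,1,3]} iar rule_reset"
proof (rule follows_frontI)
  fix n \<pi> assume a: "1 \<le> n" "\<pi> \<in> avoiders n {[1,3,2],[2,1,3]}"
  interpret nonempty_perm \<pi> n using a(2,1) by (rule nonempty_perm_avoiders)
  show "image_mset (\<lambda>v. iar (prepend v \<pi>)) (mset_set (front_sites {[1,3,2],[2,1,3]} \<pi>)) = rule_reset n (iar \<pi>)"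
    unfolding sites_132_213[OF a(2,1)] using n hd_range by (simp add: iar_pre nonempty rule_reset_def)
qed

lemma follows_iar_231_312: "follows (front_children {[2,3,1],[3,1,2]}) {[2,3,1],[3,1,2]} iar rule_reset"
proof (rule follows_frontI)
  fix n \<pi> assume a: "1 \<le> n" "\<pi> \<in> avoiders n {[2,3,1],[3,1,2]}"
  interpret nonempty_perm \<pi> n using a(2,1) by (rule nonempty_perm_avoiders)
  show "image_mset (\<lambda>v. iar (prepend v \<pi>)) (mset_set (front_sites {[2,3,1],[3,1,2]} \<pi>)) = rule_reset n (iar \<pi>)"
    unfolding sites_231_312[OF a(2,1)] using n hd_range by (simp add: iar_pre nonempty rule_reset_def)
qed

lemma follows_comp_231_312: "follows (front_children {[2,3,1],[3,1,2]}) {[2,3,1],[3,1,2]} comp_stat rule_stay"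
proof (rule follows_frontI)
  fix n \<pi> assume a: "1 \<le> n" "\<pi> \<in> avoiders n {[2,3,1],[3,1,2]}"
  interpret nonempty_perm \<pi> n using a(2,1) by (rule nonempty_perm_avoiders)
  show "image_mset (\<lambda>v. comp_stat (prepend v \<pi>)) (mset_set (front_sites {[2,3,1],[3,1,2]} \<pi>)) = rule_stay n (comp_stat \<pi>)"
    unfolding sites_231_312[OF a(2,1)] using n hd_range
    by (simp add: comp_pre_1[simplified] comp_pre_Suc_hd rule_stay_def)
qed

lemma follows_comp_312_321: "follows (front_children {[3,1,2],[3,2,1]}) {[3,1,2],[3,2,1]} comp_stat rule_stay"
proof (rule follows_frontI)
  fix n \<pi> assume a: "1 \<le> n" "\<pi> \<in> avoiders n {[3,1,2],[3,2,1]}"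
  interpret nonempty_perm \<pi> n using a(2,1) by (rule nonempty_perm_avoiders)
  show "image_mset (\<lambda>v. comp_stat (prepend v \<pi>)) (mset_set (front_sites {[3,1,2],[3,2,1]} \<pi>)) = rule_stay n (comp_stat \<pi>)"
    unfolding sites_312_321[OF a(2,1)]
    by (simp add: comp_pre_1[simplified] comp_pre_2 rule_stay_def)
qed

lemma follows_iar_132_312: "follows (back_children {[1,3,2],[3,1,2]}) {[1,3,2],[3,1,2]} iar rule_split"
proof (rule follows_backI)
  fix n \<pi> assume a: "1 \<le> n" "\<pi> \<in> avoiders n {[1,3,2],[3,1,2]}"
  interpret nonempty_perm \<pi> n using a(2,1) by (rule nonempty_perm_avoiders)
  show "image_mset (\<lambda>v. iar (postpend v \<pi>)) (mset_set (back_sites {[1,3,2],[3,1,2]} \<pi>)) = rule_split n (iar \<pi>)"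
    unfolding sites_132_312[OF a(2,1)] using n by (simp add: iar_app[OF perm n] rule_split_def)
qed

lemma follows_comp_132_312: "follows (back_children {[1,3,2],[3,1,2]}) {[1,3,2],[3,1,2]} comp_stat rule_reset"
proof (rule follows_backI)
  fix n \<pi> assume a: "1 \<le> n" "\<pi> \<in> avoiders n {[1,3,2],[3,1,2]}"
  interpret nonempty_perm \<pi> n using a(2,1) by (rule nonempty_perm_avoiders)
  show "image_mset (\<lambda>v. comp_stat (postpend v \<pi>)) (mset_set (back_sites {[1,3,2],[3,1,2]} \<pi>)) = rule_reset n (comp_stat \<pi>)"
    unfolding sites_132_312[OF a(2,1)] using n by (simp add: comp_app_1[simplified] comp_app_max rule_reset_def)
qed

lemma follows_iar_231_321: "follows (back_children {[2,3,1],[3,2,1]}) {[2,3,1],[3,2,1]} iar rule_split"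
proof (rule follows_backI)
  fix n \<pi> assume a: "1 \<le> n" "\<pi> \<in> avoiders n {[2,3,1],[3,2,1]}"
  interpret nonempty_perm \<pi> n using a(2,1) by (rule nonempty_perm_avoiders)
  show "image_mset (\<lambda>v. iar (postpend v \<pi>)) (mset_set (back_sites {[2,3,1],[3,2,1]} \<pi>)) = rule_split n (iar \<pi>)"
    unfolding sites_231_321[OF a(2,1)] using n by (simp add: iar_app[OF perm n] rule_split_def)
qed

lemma follows_comp_231_321: "follows (back_children {[2,3,1],[3,2,1]}) {[2,3,1],[3,2,1]} comp_stat rule_stay"
proof (rule follows_backI)
  fix n \<pi> assume a: "1 \<le> n" "\<pi> \<in> avoiders n {[2,3,1],[3,2,1]}"
  interpret nonempty_perm \<pi> n using a(2,1) by (rule nonempty_perm_avoiders)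
  show "image_mset (\<lambda>v. comp_stat (postpend v \<pi>)) (mset_set (back_sites {[2,3,1],[3,2,1]} \<pi>)) = rule_stay n (comp_stat \<pi>)"
    unfolding sites_231_321[OF a(2,1)] using n by (simp add: comp_app_n comp_app_max rule_stay_def)
qed

lemma follows_comp_123_132:
  "follows (front_children {[1,2,3],[1,3,2]}) {[1,2,3],[1,3,2]} (\<lambda>\<pi>. (comp_stat \<pi>, last \<pi> = length \<pi>)) rule_few"
proof (rule follows_frontI)
  fix n \<pi> assume a: "1 \<le> n" "\<pi> \<in> avoiders n {[1,2,3],[1,3,2]}"
  interpret nonempty_perm \<pi> n using a(2,1) by (rule nonempty_perm_avoiders)
  have "bump (Suc n) (last \<pi>) \<noteq> Suc n" "bump n (last \<pi>) = Suc n \<longleftrightarrow> last \<pi> = n"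
    using last_range by (auto simp: bump_def)
  then show "image_mset (\<lambda>v. (comp_stat (prepend v \<pi>), last (prepend v \<pi>) = length (prepend v \<pi>)))
      (mset_set (front_sites {[1,2,3],[1,3,2]} \<pi>)) = rule_few n (comp_stat \<pi>, last \<pi> = length \<pi>)"
    unfolding sites_123_132[OF a(2,1)]
    by (simp add: comp_pre_n comp_pre_max last_pre nonempty len)
qed

lemma follows_comp_123_213:
  "follows (back_children {[1,2,3],[2,1,3]}) {[1,2,3],[2,1,3]} (\<lambda>\<pi>. (comp_stat \<pi>, hd \<pi> = 1)) rule_few"
proof (rule follows_backI)
  fix n \<pi> assume a: "1 \<le> n" "\<pi> \<in> avoiders n {[1,2,3],[2,1,3]}"
  interpret nonempty_perm \<pi> n using a(2,1) by (rule nonempty_perm_avoiders)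
  have "bump 1 (hd \<pi>) \<noteq> 1" "bump 2 (hd \<pi>) = 1 \<longleftrightarrow> hd \<pi> = 1"
    using hd_range by (auto simp: bump_def)
  then show "image_mset (\<lambda>v. (comp_stat (postpend v \<pi>), hd (postpend v \<pi>) = 1))
      (mset_set (back_sites {[1,2,3],[2,1,3]} \<pi>)) = rule_few n (comp_stat \<pi>, hd \<pi> = 1)"
    unfolding sites_123_213[OF a(2,1)]
    by (simp add: comp_app_1[simplified] comp_app_2 hd_app nonempty)
qed

lemma follows_comp_132_321:
  "follows (back_children {[1,3,2],[3,2,1]}) {[1,3,2],[3,2,1]}
     (\<lambda>\<pi>. (comp_stat \<pi>, hd \<pi> = 1, no_rise_across (hd \<pi>) \<pi>)) rule_rise"
proof (rule follows_backI)
  fix n \<pi> assume a: "1 \<le> n" "\<pi> \<in> avoiders n {[1,3,2],[3,2,1]}"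
  interpret nonempty_perm \<pi> n using a(2,1) by (rule nonempty_perm_avoiders)
  let ?T = "\<lambda>\<pi>. (comp_stat \<pi>, hd \<pi> = 1, no_rise_across (hd \<pi>) \<pi>)"
  have max: "?T (postpend (Suc n) \<pi>) = (Suc (comp_stat \<pi>), hd \<pi> = 1, hd \<pi> = 1)"
  proof -
    have "(\<forall>a\<in>set \<pi>. \<not> (a < hd \<pi> \<and> hd \<pi> < Suc n)) \<longleftrightarrow> hd \<pi> = 1"
      unfolding set by (rule iffI, drule bspec[of _ _ 1]) (use hd_range n in auto)
    moreover have "bump (Suc n) (hd \<pi>) = hd \<pi>" using hd_range by (simp add: bump_def)
    ultimately show ?thesis
      using no_rise_across_app[of "Suc n" "hd \<pi>" \<pi>] no_rise_hd_1
      by (auto simp: comp_app_max hd_app nonempty)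
  qed
  have other: "?T (postpend (hd \<pi>) \<pi>) = (1, False, True)" if "no_rise_across (hd \<pi>) \<pi>"
    using that no_rise_across_app[of "hd \<pi>" "hd \<pi>" \<pi>] hd_range
    by (simp add: comp_app_hd hd_app nonempty) (simp add: bump_def)
  have "hd \<pi> \<noteq> Suc n" using hd_range by simp
  then show "image_mset (\<lambda>v. ?T (postpend v \<pi>)) (mset_set (back_sites {[1,3,2],[3,2,1]} \<pi>)) = rule_rise n (?T \<pi>)"
    unfolding sites_132_321[OF a(2,1)] using max other by simp
qed

lemma follows_comp_213_321:
  "follows (front_children {[2,1,3],[3,2,1]}) {[2,1,3],[3,2,1]}
     (\<lambda>\<pi>. (comp_stat \<pi>, last \<pi> = length \<pi>, no_rise_across (last \<pi>) \<pi>)) rule_rise"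
proof (rule follows_frontI)
  fix n \<pi> assume a: "1 \<le> n" "\<pi> \<in> avoiders n {[2,1,3],[3,2,1]}"
  interpret nonempty_perm \<pi> n using a(2,1) by (rule nonempty_perm_avoiders)
  let ?T = "\<lambda>\<pi>. (comp_stat \<pi>, last \<pi> = length \<pi>, no_rise_across (last \<pi>) \<pi>)"
  have one: "?T (prepend 1 \<pi>) = (Suc (comp_stat \<pi>), last \<pi> = n, last \<pi> = n)"
  proof -
    have "(\<forall>c\<in>set \<pi>. \<not> (1 \<le> last \<pi> \<and> last \<pi> < c)) \<longleftrightarrow> last \<pi> = n"
      using last_range n unfolding set by fastforce
    moreover have "bump 1 (last \<pi>) = Suc (last \<pi>)" using last_range by (simp add: bump_def)
    ultimately show ?thesis
      using no_rise_across_pre[of 1 "last \<pi>" \<pi>] no_rise_last_n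
      by (auto simp: comp_pre_1[simplified] last_pre nonempty len)
  qed
  have other: "?T (prepend (Suc (last \<pi>)) \<pi>) = (1, False, True)" if "no_rise_across (last \<pi>) \<pi>"
    using that no_rise_across_pre[of "Suc (last \<pi>)" "last \<pi>" \<pi>] last_range
    by (simp add: comp_pre_Suc_last last_pre nonempty len) (simp add: bump_def)
  have "Suc (last \<pi>) \<noteq> 1" using last_range by simp
  then show "image_mset (\<lambda>v. ?T (prepend v \<pi>)) (mset_set (front_sites {[2,1,3],[3,2,1]} \<pi>)) = rule_rise n (?T \<pi>)"
    unfolding sites_213_321[OF a(2,1)] using one other by (simp add: len)
qed

lemma follows_comp_123_231:
  "follows (front_children {[1,2,3],[2,3,1]}) {[1,2,3],[2,3,1]}
     (\<lambda>\<pi>. (comp_stat \<pi>, last \<pi> = 1, no_fall_across (last \<pi>) \<pi>)) rule_fall"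
proof (rule follows_frontI)
  fix n \<pi> assume a: "1 \<le> n" "\<pi> \<in> avoiders n {[1,2,3],[2,3,1]}"
  interpret nonempty_perm \<pi> n using a(2,1) by (rule nonempty_perm_avoiders)
  let ?T = "\<lambda>\<pi>. (comp_stat \<pi>, last \<pi> = 1, no_fall_across (last \<pi>) \<pi>)"
  have max: "?T (prepend (Suc n) \<pi>) = (1, last \<pi> = 1, last \<pi> = 1)"
  proof -
    have "(\<forall>a\<in>set \<pi>. \<not> (a < last \<pi> \<and> last \<pi> < Suc n)) \<longleftrightarrow> last \<pi> = 1"
      unfolding set by (rule iffI, drule bspec[of _ _ 1]) (use last_range n in auto)
    moreover have "bump (Suc n) (last \<pi>) = last \<pi>" using last_range by (simp add: bump_def)
    ultimately show ?thesis
      using no_fall_across_pre[of "Suc n" "last \<pi>" \<pi>] no_fall_last_1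
      by (auto simp: comp_pre_max last_pre nonempty)
  qed
  have other: "?T (prepend (last \<pi>) \<pi>) = (2, False, True)" if "no_fall_across (last \<pi>) \<pi>"
    using that no_fall_across_pre[of "last \<pi>" "last \<pi>" \<pi>] last_range
    by (simp add: comp_pre_last last_pre nonempty) (simp add: bump_def)
  have "last \<pi> \<noteq> Suc n" using last_range by simp
  then show "image_mset (\<lambda>v. ?T (prepend v \<pi>)) (mset_set (front_sites {[1,2,3],[2,3,1]} \<pi>)) = rule_fall n (?T \<pi>)"
    unfolding sites_123_231[OF a(2,1)] using max other by simp
qed

lemma follows_comp_123_312:
  "follows (back_children {[1,2,3],[3,1,2]}) {[1,2,3],[3,1,2]}
     (\<lambda>\<pi>. (comp_stat \<pi>, hd \<pi> = length \<pi>, no_fall_across (hd \<pi>) \<pi>)) rule_fall"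
proof (rule follows_backI)
  fix n \<pi> assume a: "1 \<le> n" "\<pi> \<in> avoiders n {[1,2,3],[3,1,2]}"
  interpret nonempty_perm \<pi> n using a(2,1) by (rule nonempty_perm_avoiders)
  let ?T = "\<lambda>\<pi>. (comp_stat \<pi>, hd \<pi> = length \<pi>, no_fall_across (hd \<pi>) \<pi>)"
  have one: "?T (postpend 1 \<pi>) = (1, hd \<pi> = n, hd \<pi> = n)"
  proof -
    have "(\<forall>c\<in>set \<pi>. \<not> (1 \<le> hd \<pi> \<and> hd \<pi> < c)) \<longleftrightarrow> hd \<pi> = n"
      using hd_range n unfolding set by fastforce
    moreover have "bump 1 (hd \<pi>) = Suc (hd \<pi>)" using hd_range by (simp add: bump_def)
    ultimately show ?thesis
      using no_fall_across_app[of 1 "hd \<pi>" \<pi>] no_fall_hd_n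
      by (auto simp: comp_app_1[simplified] hd_app nonempty len)
  qed
  have other: "?T (postpend (Suc (hd \<pi>)) \<pi>) = (2, False, True)" if "no_fall_across (hd \<pi>) \<pi>"
    using that no_fall_across_app[of "Suc (hd \<pi>)" "hd \<pi>" \<pi>] hd_range
    by (simp add: comp_app_Suc_hd hd_app nonempty len) (simp add: bump_def)
  have "Suc (hd \<pi>) \<noteq> 1" using hd_range by simp
  then show "image_mset (\<lambda>v. ?T (postpend v \<pi>)) (mset_set (back_sites {[1,2,3],[3,1,2]} \<pi>)) = rule_fall n (?T \<pi>)"
    unfolding sites_123_312[OF a(2,1)] using one other by (simp add: len)
qed

section \<open>Classes grown at both ends\<close>

lemma pre_neq_app:
  assumes "\<pi> \<noteq> []" "\<rho> \<noteq> []"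
  shows "prepend v \<pi> \<noteq> postpend v \<rho>"
proof
  assume "prepend v \<pi> = postpend v \<rho>"
  then have "hd (prepend v \<pi>) = hd (postpend v \<rho>)" by simp
  then show False using assms by (simp add: prepend_def hd_app) (metis bump_eq(2))
qed

lemma generatesD: "generates ch P \<Longrightarrow> 1 \<le> n \<Longrightarrow> avoiders (Suc n) P = (\<Union>\<pi>\<in>avoiders n P. ch \<pi>)"
  by (simp add: generates_def)

text \<open>
  At a single end the number of active sites is unbounded in the two classes treated here. But a fixed extreme value must stand at one of the two ends. The two children of a node are obtained by
  putting it at the front and at the back.
\<close>

lemma generates_ends:
  assumes P: "P \<subseteq> perms 3"
    and sites: "\<And>n \<pi>. 1 \<le> n \<Longrightarrow> \<pi> \<in> avoiders n P \<Longrightarrow> m n \<in> front_sites P \<pi> \<and> m n \<in> back_sites P \<pi>"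
    and ends: "\<And>n \<rho>. 1 \<le> n \<Longrightarrow> \<rho> \<in> avoiders (Suc n) P \<Longrightarrow> hd \<rho> = m n \<or> last \<rho> = m n"
  shows "generates (\<lambda>\<pi>. {prepend (m (length \<pi>)) \<pi>, postpend (m (length \<pi>)) \<pi>}) P"
proof -
  let ?ch = "\<lambda>\<pi>. {prepend (m (length \<pi>)) \<pi>, postpend (m (length \<pi>)) \<pi>}"
  have gen: "avoiders (Suc n) P = (\<Union>\<pi>\<in>avoiders n P. front_children P \<pi>)"
    "avoiders (Suc n) P = (\<Union>\<pi>\<in>avoiders n P. back_children P \<pi>)" if "1 \<le> n" for n
    by (rule generatesD[OF generates_front[OF P] that], rule generatesD[OF generates_back[OF P] that])
  have len: "length \<pi> = n" if "\<pi> \<in> avoiders n P" for n \<pi>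
    using permsD(3)[OF avoidersD(1)[OF that]] .
  have "avoiders (Suc n) P = (\<Union>\<pi>\<in>avoiders n P. ?ch \<pi>)" if n: "1 \<le> n" for n
  proof (intro set_eqI iffI)
    fix \<rho> assume r: "\<rho> \<in> avoiders (Suc n) P"
    from ends[OF n r] show "\<rho> \<in> (\<Union>\<pi>\<in>avoiders n P. ?ch \<pi>)"
    proof
      assume h: "hd \<rho> = m n"
      obtain \<pi> v where "\<pi> \<in> avoiders n P" "\<rho> = prepend v \<pi>" using r gen(1)[OF n] by blast
      with h show ?thesis using len by (auto simp: prepend_def)
    next
      assume h: "last \<rho> = m n"
      obtain \<pi> v where "\<pi> \<in> avoiders n P" "\<rho> = postpend v \<pi>" using r gen(2)[OF n] by blast
      with h show ?thesis using len by (auto simp: postpend_def)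
    qed
  next
    fix \<rho> assume "\<rho> \<in> (\<Union>\<pi>\<in>avoiders n P. ?ch \<pi>)"
    then obtain \<pi> where p: "\<pi> \<in> avoiders n P" "\<rho> = prepend (m n) \<pi> \<or> \<rho> = postpend (m n) \<pi>"
      using len by auto
    show "\<rho> \<in> avoiders (Suc n) P"
      using p(2)
    proof
      assume "\<rho> = prepend (m n) \<pi>"
      then show ?thesis unfolding gen(1)[OF n] using p(1) sites[OF n p(1)] by blast
    next
      assume "\<rho> = postpend (m n) \<pi>"
      then show ?thesis unfolding gen(2)[OF n] using p(1) sites[OF n p(1)] by blast
    qed
  qed
  moreover have "disjoint_family_on ?ch (avoiders n P)" if n: "1 \<le> n" for n
  proof -
    have "\<pi> \<noteq> []" if "\<pi> \<in> avoiders n P" for \<pi> using len[OF that] n by auto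
    then show ?thesis
      using len by (auto simp: disjoint_family_on_def pre_eq_iff app_eq_iff pre_neq_app pre_neq_app[symmetric])
  qed
  ultimately show ?thesis unfolding generates_def by simp
qed

lemma follows_endsI:
  assumes "\<And>n \<pi>. 1 \<le> n \<Longrightarrow> \<pi> \<in> avoiders n P \<Longrightarrow> {#T (prepend (m n) \<pi>), T (postpend (m n) \<pi>)#} = H n (T \<pi>)"
  shows "follows (\<lambda>\<pi>. {prepend (m (length \<pi>)) \<pi>, postpend (m (length \<pi>)) \<pi>}) P T H"
  unfolding follows_def
proof (intro allI impI ballI)
  fix n \<pi> assume a: "1 \<le> n" "\<pi> \<in> avoiders n P"
  then have "length \<pi> = n" using permsD(3) avoidersD(1) by blast
  moreover from this have "\<pi> \<noteq> []" using a(1) by auto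
  ultimately show "image_mset T (mset_set {prepend (m (length \<pi>)) \<pi>, postpend (m (length \<pi>)) \<pi>}) = H n (T \<pi>)"
    using assms[OF a] by (simp add: pre_neq_app)
qed

text \<open>
  An extreme value in the interior forms, together with the two end entries, one of the two forbidden
  patterns; the order of the end entries decides which one.
\<close>

lemma interior_subseq3:
  assumes "\<rho> \<in> perms n" "u \<in> {1..n}" "hd \<rho> \<noteq> u" "last \<rho> \<noteq> u"
  shows "subseq [hd \<rho>, u, last \<rho>] \<rho>" "hd \<rho> \<in> {1..n}" "last \<rho> \<in> {1..n}" "hd \<rho> \<noteq> last \<rho>"
proof -
  interpret nonempty_perm \<rho> n using assms by unfold_locales auto
  have "subseq [u, last \<rho>] \<rho>" using assms sub_last[of u] by auto
  then show s: "subseq [hd \<rho>, u, last \<rho>] \<rho>" using assms by (intro sub3_hd) auto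
  show "hd \<rho> \<in> {1..n}" "last \<rho> \<in> {1..n}" using hd_range last_range by auto
  show "hd \<rho> \<noteq> last \<rho>"
    using sub_hd[of u] sub_last[of u] subseq2D(4)[of u "hd \<rho>" \<rho>] assms dist by auto
qed

lemma perms_3: "perms 3 = {[1,2,3], [1,3,2], [2,1,3], [2,3,1], [3,1,2], [3,2,1]}"
proof -
  have "{1..3} = set [1, 2, 3 :: nat]" by auto
  then have "perms 3 = set (permutations_of_set_list (remdups [1, 2, 3]))"
    by (simp only: permutations_of_list)
  also have "permutations_of_set_list (remdups [1, 2, 3 :: nat]) =
      [[3, 2, 1], [2, 3, 1], [3, 1, 2], [1, 3, 2], [2, 1, 3], [1, 2, 3]]"
    by code_simp
  finally show ?thesis by auto
qed

lemma patterns_3: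
  "{[1,2,3],[1,3,2]} \<subseteq> perms 3" "{[1,2,3],[2,1,3]} \<subseteq> perms 3" "{[1,2,3],[2,3,1]} \<subseteq> perms 3"
  "{[1,2,3],[3,1,2]} \<subseteq> perms 3" "{[1,2,3],[3,2,1]} \<subseteq> perms 3" "{[1,3,2],[2,1,3]} \<subseteq> perms 3"
  "{[1,3,2],[2,3,1]} \<subseteq> perms 3" "{[1,3,2],[3,1,2]} \<subseteq> perms 3" "{[1,3,2],[3,2,1]} \<subseteq> perms 3"
  "{[2,1,3],[2,3,1]} \<subseteq> perms 3" "{[2,1,3],[3,1,2]} \<subseteq> perms 3" "{[2,1,3],[3,2,1]} \<subseteq> perms 3"
  "{[2,3,1],[3,1,2]} \<subseteq> perms 3" "{[2,3,1],[3,2,1]} \<subseteq> perms 3" "{[3,1,2],[3,2,1]} \<subseteq> perms 3"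
  unfolding perms_3 by simp_all

lemma generates_132_231:
  "generates (\<lambda>\<pi>. {prepend (Suc (length \<pi>)) \<pi>, postpend (Suc (length \<pi>)) \<pi>}) {[1,3,2],[2,3,1]}"
proof (rule generates_ends)
  fix n \<pi> assume a: "1 \<le> n" "\<pi> \<in> avoiders n {[1,3,2],[2,3,1]}"
  interpret nonempty_perm \<pi> n using a(2,1) by (rule nonempty_perm_avoiders)
  have p: "v \<in> front_sites {[1,3,2],[2,3,1]} \<pi> \<longleftrightarrow> 1 \<le> v \<and> v \<le> Suc n \<and>
      (\<forall>y z. subseq [y, z] \<pi> \<longrightarrow> \<not> (v \<le> y \<and> z < y))" for v
    by (rule front_sites_iff[OF a(2)]) presburger
  have q: "v \<in> back_sites {[1,3,2],[2,3,1]} \<pi> \<longleftrightarrow> 1 \<le> v \<and> v \<le> Suc n \<and>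
      (\<forall>y z. subseq [y, z] \<pi> \<longrightarrow> \<not> (v \<le> z \<and> y < z))" for v
    by (rule back_sites_iff[OF a(2)]) presburger
  show "Suc n \<in> front_sites {[1,3,2],[2,3,1]} \<pi> \<and> Suc n \<in> back_sites {[1,3,2],[2,3,1]} \<pi>"
    unfolding p q by (auto dest!: sub_range)
next
  fix n \<rho> assume r: "1 \<le> n" "\<rho> \<in> avoiders (Suc n) {[1,3,2],[2,3,1]}"
  show "hd \<rho> = Suc n \<or> last \<rho> = Suc n"
  proof (rule ccontr)
    assume neg: "\<not> (hd \<rho> = Suc n \<or> last \<rho> = Suc n)"
    then have i: "subseq [hd \<rho>, Suc n, last \<rho>] \<rho>" "hd \<rho> \<le> Suc n" "last \<rho> \<le> Suc n" "hd \<rho> \<noteq> last \<rho>"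
      using interior_subseq3[OF avoidersD(1)[OF r(2)], of "Suc n"] by auto
    from avoids3[OF r(2) _ i(1), of 1 3 2] avoids3[OF r(2) _ i(1), of 2 3 1]
    show False using i(2-4) neg by auto
  qed
qed (rule patterns_3)

lemma generates_213_312: "generates (\<lambda>\<pi>. {prepend 1 \<pi>, postpend 1 \<pi>}) {[2,1,3],[3,1,2]}"
proof (rule generates_ends[where m = "\<lambda>_. 1"])
  fix n \<pi> assume a: "1 \<le> n" "\<pi> \<in> avoiders n {[2,1,3],[3,1,2]}"
  interpret nonempty_perm \<pi> n using a(2,1) by (rule nonempty_perm_avoiders)
  have p: "v \<in> front_sites {[2,1,3],[3,1,2]} \<pi> \<longleftrightarrow> 1 \<le> v \<and> v \<le> Suc n \<and>
      (\<forall>y z. subseq [y, z] \<pi> \<longrightarrow> \<not> (y < v \<and> y < z))" for v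
    by (rule front_sites_iff[OF a(2)]) presburger
  have q: "v \<in> back_sites {[2,1,3],[3,1,2]} \<pi> \<longleftrightarrow> 1 \<le> v \<and> v \<le> Suc n \<and>
      (\<forall>y z. subseq [y, z] \<pi> \<longrightarrow> \<not> (z < v \<and> z < y))" for v
    by (rule back_sites_iff[OF a(2)]) presburger
  show "1 \<in> front_sites {[2,1,3],[3,1,2]} \<pi> \<and> 1 \<in> back_sites {[2,1,3],[3,1,2]} \<pi>"
    unfolding p q by (auto dest!: sub_range)
next
  fix n \<rho> assume r: "1 \<le> n" "\<rho> \<in> avoiders (Suc n) {[2,1,3],[3,1,2]}"
  show "hd \<rho> = 1 \<or> last \<rho> = 1"
  proof (rule ccontr)
    assume neg: "\<not> (hd \<rho> = 1 \<or> last \<rho> = 1)"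
    then have i: "subseq [hd \<rho>, 1, last \<rho>] \<rho>" "1 \<le> hd \<rho>" "1 \<le> last \<rho>" "hd \<rho> \<noteq> last \<rho>"
      using interior_subseq3[OF avoidersD(1)[OF r(2)], of 1] by auto
    from avoids3[OF r(2) _ i(1), of 2 1 3] avoids3[OF r(2) _ i(1), of 3 1 2]
    show False using i(2-4) neg by auto
  qed
qed (rule patterns_3)

lemma follows_comp_132_231:
  "follows (\<lambda>\<pi>. {prepend (Suc (length \<pi>)) \<pi>, postpend (Suc (length \<pi>)) \<pi>}) {[1,3,2],[2,3,1]} comp_stat rule_reset"
proof (rule follows_endsI)
  fix n \<pi> assume a: "1 \<le> n" "\<pi> \<in> avoiders n {[1,3,2],[2,3,1]}"
  interpret nonempty_perm \<pi> n using a(2,1) by (rule nonempty_perm_avoiders)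
  show "{#comp_stat (prepend (Suc n) \<pi>), comp_stat (postpend (Suc n) \<pi>)#} = rule_reset n (comp_stat \<pi>)"
    by (simp add: comp_pre_max comp_app_max rule_reset_def)
qed

lemma follows_comp_213_312:
  "follows (\<lambda>\<pi>. {prepend 1 \<pi>, postpend 1 \<pi>}) {[2,1,3],[3,1,2]} comp_stat rule_reset"
proof (rule follows_endsI[where m = "\<lambda>_. 1"])
  fix n \<pi> assume a: "1 \<le> n" "\<pi> \<in> avoiders n {[2,1,3],[3,1,2]}"
  interpret nonempty_perm \<pi> n using a(2,1) by (rule nonempty_perm_avoiders)
  show "{#comp_stat (prepend 1 \<pi>), comp_stat (postpend 1 \<pi>)#} = rule_reset n (comp_stat \<pi>)"
    by (simp add: comp_pre_1[simplified] comp_app_1[simplified] rule_reset_def)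
qed

section \<open>Distributions\<close>

text \<open>
  The initial runs of the permutations of \<open>[n + 1]\<close> other than the increasing one, in a class that
  follows \<open>rule_reset\<close>: the value \<open>k\<close> occurs \<open>2 ^ (n - k)\<close> times for \<open>1 \<le> k \<le> n\<close>.
\<close>

primrec small_runs :: "nat \<Rightarrow> nat multiset" where
  "small_runs 0 = {#}"
| "small_runs (Suc n) = add_mset (Suc n) (small_runs n + small_runs n)"

lemma small_runs_le: "k \<in># small_runs n \<Longrightarrow> k \<le> n"
  by (induction n) (auto simp: le_Suc_eq)

lemma size_small_runs: "Suc (size (small_runs n)) = 2 ^ n"
  by (induction n) auto

text \<open>
  The same multiset can be built by doubling, as \<open>rule_split\<close> does, or by shifting and adding ones, as
  \<open>rule_reset\<close> does. This reconciles the classes that grow at the front with those that grow at the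
  back.
\<close>

lemma small_runs_shift:
  "small_runs (Suc n) = image_mset Suc (small_runs n) + replicate_mset (2 ^ n) 1"
proof (induction n)
  case (Suc n)
  have r: "replicate_mset (2 ^ Suc n) (1::nat) = replicate_mset (2 ^ n) 1 + replicate_mset (2 ^ n) 1"
    by (rule multiset_eqI) simp
  let ?S = "image_mset Suc (small_runs n)" and ?r = "replicate_mset (2 ^ n) (1::nat)"
  have "small_runs (Suc (Suc n)) = add_mset (Suc (Suc n)) ((?S + ?r) + (?S + ?r))"
    by (simp only: small_runs.simps(2)[of "Suc n"] Suc)
  moreover have "image_mset Suc (small_runs (Suc n)) = add_mset (Suc (Suc n)) (?S + ?S)" by simp
  ultimately show ?case unfolding r by (simp add: ac_simps)
qed simp

lemma level_reset: "level rule_reset 1 n = add_mset (Suc n) (small_runs n)"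
proof (induction n)
  case (Suc n)
  have "(\<Sum>s\<in>#M. rule_reset k s) = image_mset Suc M + replicate_mset (size M) 1" for M k
    by (induction M) (auto simp: rule_reset_def)
  then have "level rule_reset 1 (Suc n) =
      image_mset Suc (add_mset (Suc n) (small_runs n)) + replicate_mset (size (add_mset (Suc n) (small_runs n))) 1"
    by (simp only: level.simps Suc)
  also have "size (add_mset (Suc n) (small_runs n)) = 2 ^ n"
    using size_small_runs by simp
  finally show ?case unfolding small_runs_shift by simp
qed simp

lemma level_split: "level rule_split 1 n = add_mset (Suc n) (small_runs n)"
proof (induction n)
  case (Suc n)
  have "(\<Sum>s\<in>#M. rule_split k s) = M + M" if "k \<notin># M" for M k
    using that by (induction M) (auto simp: rule_split_def)
  then have "(\<Sum>s\<in>#small_runs n. rule_split (Suc n) s) = small_runs n + small_runs n"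
    using small_runs_le[of "Suc n" n] by auto
  then show ?case using Suc by (simp add: rule_split_def)
qed simp

lemma size_level_double:
  assumes "\<And>n t. size (H n t) = 2"
  shows "size (level H t n) = 2 ^ n"
proof (induction n)
  case (Suc n)
  have "size (\<Sum>s\<in>#M. H k s) = 2 * size M" for M k
    by (induction M) (simp_all add: assms)
  then show ?case by (simp only: level.simps Suc power_Suc)
qed simp

lemma level_map:
  assumes "\<And>n t. image_mset g (H n t) = H' n (g t)"
  shows "image_mset g (level H t n) = level H' (g t) n"
proof (induction n)
  case (Suc n)
  have "image_mset g (\<Sum>s\<in>#M. H (Suc n) s) = (\<Sum>s\<in>#image_mset g M. H' (Suc n) s)" for M
    by (induction M) (auto simp: assms)
  then show ?case using Suc by simp
qed simp

text \<open>
  Exactly one node at each level carries the first bit, and hence exactly \<open>n + 1\<close> carry the second one;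
  each of these has one additional child.
\<close>

lemma size_level_binom: "size (level rule_binom (True, True) n) = 1 + (Suc n choose 2)"
proof -
  let ?L = "level rule_binom (True, True)"
  have all: "size (\<Sum>s\<in>#M. rule_binom k s) = size M + size (filter_mset snd M)" for M k
  proof (induction M)
    case (add t M)
    then show ?case by (cases t) simp
  qed simp
  have snd: "size (filter_mset snd (\<Sum>s\<in>#M. rule_binom k s)) =
      size (filter_mset fst M) + size (filter_mset snd M)" for M k
  proof (induction M)
    case (add t M)
    then show ?case by (cases t) simp
  qed simp
  have fst: "size (filter_mset fst (\<Sum>s\<in>#M. rule_binom k s)) = size (filter_mset fst M)" for M k
  proof (induction M)
    case (add t M)
    then show ?case by (cases t) simp
  qed simp
  have 1: "size (filter_mset fst (?L n)) = 1" for n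
  proof (induction n)
    case (Suc n)
    then show ?case by (simp only: level.simps fst)
  qed simp
  have 2: "size (filter_mset snd (?L n)) = Suc n" for n
  proof (induction n)
    case (Suc n)
    then show ?case by (simp only: level.simps snd 1)
  qed simp
  show ?thesis
  proof (induction n)
    case (Suc n)
    have "size (?L (Suc n)) = 1 + (Suc n choose 2) + Suc n"
      by (simp only: level.simps all Suc 2)
    then show ?case by (simp add: numeral_2_eq_2)
  qed simp
qed

lemma size_st_mset: "size (st_mset T n P) = card (avoiders n P)"
  by (simp add: st_mset_def)

lemma count_st_mset: "count (st_mset st n P) v = card {\<pi> \<in> avoiders n P. st \<pi> = v}"
proof -
  have "count (st_mset st n P) v = (\<Sum>\<pi>\<in>st -` {v} \<inter> avoiders n P. count (mset_set (avoiders n P)) \<pi>)"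
    by (simp add: st_mset_def count_image_mset)
  also have "\<dots> = card (st -` {v} \<inter> avoiders n P)" by simp
  also have "st -` {v} \<inter> avoiders n P = {\<pi> \<in> avoiders n P. st \<pi> = v}" by auto
  finally show ?thesis .
qed

lemma st_mset_image: "st_mset (\<lambda>\<pi>. g (T \<pi>)) n P = image_mset g (st_mset T n P)"
  by (simp add: st_mset_def image_mset.compositionality o_def)

lemma Wilf_equivI:
  assumes "\<And>n. st_mset st (Suc n) P = L n" "\<And>n. st_mset st (Suc n) Q = L n"
  shows "st_Wilf_equiv st P Q"
  unfolding st_Wilf_equiv_def count_st_mset[symmetric]
proof (intro allI impI)
  fix n v assume "1 \<le> (n::nat)"
  then obtain k where "n = Suc k" by (cases n) auto
  then show "count (st_mset st n P) v = count (st_mset st n Q) v" using assms by simp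
qed

lemma comp_single: "comp_stat [1] = 1"
proof -
  have "{i \<in> {1..length [1::nat]}. cut_at i [1]} = {1}" by (auto simp: cut_at_def)
  then show ?thesis by (simp only: comp_stat_cut) simp
qed

lemma no_across_single: "no_rise_across m [x]" "no_fall_across m [x]"
  by (simp_all add: no_rise_across_def no_fall_across_def)

lemma st_mset_iar:
  "st_mset iar (Suc n) {[1,3,2],[2,1,3]} = add_mset (Suc n) (small_runs n)"
  "st_mset iar (Suc n) {[2,1,3],[2,3,1]} = add_mset (Suc n) (small_runs n)"
  "st_mset iar (Suc n) {[2,3,1],[3,1,2]} = add_mset (Suc n) (small_runs n)"
  "st_mset iar (Suc n) {[1,3,2],[3,1,2]} = add_mset (Suc n) (small_runs n)"
  "st_mset iar (Suc n) {[2,3,1],[3,2,1]} = add_mset (Suc n) (small_runs n)"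
  by (simp_all only: iar_single level_reset level_split
    st_mset_eq_level[OF patterns_3(6) generates_front[OF patterns_3(6)] follows_iar_132_213]
    st_mset_eq_level[OF patterns_3(10) generates_front[OF patterns_3(10)] follows_iar_213_231]
    st_mset_eq_level[OF patterns_3(13) generates_front[OF patterns_3(13)] follows_iar_231_312]
    st_mset_eq_level[OF patterns_3(8) generates_back[OF patterns_3(8)] follows_iar_132_312]
    st_mset_eq_level[OF patterns_3(14) generates_back[OF patterns_3(14)] follows_iar_231_321])

lemma st_mset_comp_reset:
  "st_mset comp_stat (Suc n) {[1,3,2],[2,3,1]} = level rule_reset 1 n"
  "st_mset comp_stat (Suc n) {[1,3,2],[3,1,2]} = level rule_reset 1 n"
  "st_mset comp_stat (Suc n) {[2,1,3],[2,3,1]} = level rule_reset 1 n"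
  "st_mset comp_stat (Suc n) {[2,1,3],[3,1,2]} = level rule_reset 1 n"
  by (simp_all only: comp_single
    st_mset_eq_level[OF patterns_3(7) generates_132_231 follows_comp_132_231]
    st_mset_eq_level[OF patterns_3(8) generates_back[OF patterns_3(8)] follows_comp_132_312]
    st_mset_eq_level[OF patterns_3(10) generates_front[OF patterns_3(10)] follows_comp_213_231]
    st_mset_eq_level[OF patterns_3(11) generates_213_312 follows_comp_213_312])

lemma st_mset_comp_stay:
  "st_mset comp_stat (Suc n) {[2,3,1],[3,1,2]} = level rule_stay 1 n"
  "st_mset comp_stat (Suc n) {[2,3,1],[3,2,1]} = level rule_stay 1 n"
  "st_mset comp_stat (Suc n) {[3,1,2],[3,2,1]} = level rule_stay 1 n"
  by (simp_all only: comp_single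
    st_mset_eq_level[OF patterns_3(13) generates_front[OF patterns_3(13)] follows_comp_231_312]
    st_mset_eq_level[OF patterns_3(14) generates_back[OF patterns_3(14)] follows_comp_231_321]
    st_mset_eq_level[OF patterns_3(15) generates_front[OF patterns_3(15)] follows_comp_312_321])

lemma st_mset_comp_fst:
  assumes "P \<subseteq> perms 3" "generates ch P" "follows ch P (\<lambda>\<pi>. (comp_stat \<pi>, f \<pi>)) H" "f [1] = s"
  shows "st_mset comp_stat (Suc n) P = image_mset fst (level H (1, s) n)"
  using st_mset_image[of fst "\<lambda>\<pi>. (comp_stat \<pi>, f \<pi>)" "Suc n" P]
  unfolding fst_conv st_mset_eq_level[OF assms(1-3)] assms(4) comp_single .

lemma st_mset_comp_few:
  "st_mset comp_stat (Suc n) {[1,2,3],[1,3,2]} = image_mset fst (level rule_few (1, True) n)"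
  "st_mset comp_stat (Suc n) {[1,2,3],[2,1,3]} = image_mset fst (level rule_few (1, True) n)"
  by (rule st_mset_comp_fst[OF patterns_3(1) generates_front[OF patterns_3(1)] follows_comp_123_132], simp)
     (rule st_mset_comp_fst[OF patterns_3(2) generates_back[OF patterns_3(2)] follows_comp_123_213], simp)

lemma st_mset_comp_rise:
  "st_mset comp_stat (Suc n) {[1,3,2],[3,2,1]} = image_mset fst (level rule_rise (1, True, True) n)"
  "st_mset comp_stat (Suc n) {[2,1,3],[3,2,1]} = image_mset fst (level rule_rise (1, True, True) n)"
  by (rule st_mset_comp_fst[OF patterns_3(9) generates_back[OF patterns_3(9)] follows_comp_132_321],
      simp add: no_across_single)
     (rule st_mset_comp_fst[OF patterns_3(12) generates_front[OF patterns_3(12)] follows_comp_213_321],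
      simp add: no_across_single)

lemma st_mset_comp_fall:
  "st_mset comp_stat (Suc n) {[1,2,3],[2,3,1]} = image_mset fst (level rule_fall (1, True, True) n)"
  "st_mset comp_stat (Suc n) {[1,2,3],[3,1,2]} = image_mset fst (level rule_fall (1, True, True) n)"
  by (rule st_mset_comp_fst[OF patterns_3(3) generates_front[OF patterns_3(3)] follows_comp_123_231],
      simp add: no_across_single)
     (rule st_mset_comp_fst[OF patterns_3(4) generates_back[OF patterns_3(4)] follows_comp_123_312],
      simp add: no_across_single)

lemma card_avoiders_pow2_iar:
  "card (avoiders (Suc n) {[1,3,2],[2,1,3]}) = 2 ^ n" "card (avoiders (Suc n) {[1,3,2],[3,1,2]}) = 2 ^ n"
  "card (avoiders (Suc n) {[2,1,3],[2,3,1]}) = 2 ^ n" "card (avoiders (Suc n) {[2,3,1],[3,1,2]}) = 2 ^ n"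
  "card (avoiders (Suc n) {[2,3,1],[3,2,1]}) = 2 ^ n"
  by (simp_all only: size_st_mset[of iar, symmetric] st_mset_iar size_add_mset size_small_runs)

lemma card_avoiders_pow2_comp:
  "card (avoiders (Suc n) {[1,3,2],[2,3,1]}) = 2 ^ n" "card (avoiders (Suc n) {[2,1,3],[3,1,2]}) = 2 ^ n"
  "card (avoiders (Suc n) {[3,1,2],[3,2,1]}) = 2 ^ n" "card (avoiders (Suc n) {[1,2,3],[1,3,2]}) = 2 ^ n"
  "card (avoiders (Suc n) {[1,2,3],[2,1,3]}) = 2 ^ n"
proof -
  have r: "size (rule_reset n t) = 2" for n t by (simp add: rule_reset_def)
  have s: "size (rule_stay n t) = 2" for n t by (simp add: rule_stay_def)
  have f: "size (rule_few n t) = 2" for n t by (cases t) simp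
  note size = size_level_double[of rule_reset, OF r] size_level_double[of rule_stay, OF s]
    size_level_double[of rule_few, OF f]
  show "card (avoiders (Suc n) {[1,3,2],[2,3,1]}) = 2 ^ n" "card (avoiders (Suc n) {[2,1,3],[3,1,2]}) = 2 ^ n"
    "card (avoiders (Suc n) {[3,1,2],[3,2,1]}) = 2 ^ n" "card (avoiders (Suc n) {[1,2,3],[1,3,2]}) = 2 ^ n"
    "card (avoiders (Suc n) {[1,2,3],[2,1,3]}) = 2 ^ n"
    by (simp_all only: size_st_mset[of comp_stat, symmetric] st_mset_comp_reset st_mset_comp_stay
      st_mset_comp_few size_image_mset size)
qed

lemma card_avoiders_binom:
  "card (avoiders (Suc n) {[1,3,2],[3,2,1]}) = 1 + (Suc n choose 2)"
  "card (avoiders (Suc n) {[2,1,3],[3,2,1]}) = 1 + (Suc n choose 2)"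
  "card (avoiders (Suc n) {[1,2,3],[2,3,1]}) = 1 + (Suc n choose 2)"
  "card (avoiders (Suc n) {[1,2,3],[3,1,2]}) = 1 + (Suc n choose 2)"
proof -
  have r: "image_mset snd (rule_rise k t) = rule_binom k (snd t)" for k t by (cases t) simp
  have f: "image_mset snd (rule_fall k t) = rule_binom k (snd t)" for k t by (cases t) simp
  have "size (level rule_rise (1, True, True) n) = size (image_mset snd (level rule_rise (1, True, True) n))"
    "size (level rule_fall (1, True, True) n) = size (image_mset snd (level rule_fall (1, True, True) n))"
    by (simp_all only: size_image_mset)
  then have size: "size (level rule_rise (1, True, True) n) = 1 + (Suc n choose 2)"
    "size (level rule_fall (1, True, True) n) = 1 + (Suc n choose 2)"
    by (simp_all only: level_map[of snd rule_rise rule_binom, OF r]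
      level_map[of snd rule_fall rule_binom, OF f] snd_conv size_level_binom)
  show "card (avoiders (Suc n) {[1,3,2],[3,2,1]}) = 1 + (Suc n choose 2)"
    "card (avoiders (Suc n) {[2,1,3],[3,2,1]}) = 1 + (Suc n choose 2)"
    "card (avoiders (Suc n) {[1,2,3],[2,3,1]}) = 1 + (Suc n choose 2)"
    "card (avoiders (Suc n) {[1,2,3],[3,1,2]}) = 1 + (Suc n choose 2)"
    by (simp_all only: size_st_mset[of comp_stat, symmetric] st_mset_comp_rise st_mset_comp_fall
      size_image_mset size)
qed

section \<open>Separating classes by permutations of length four\<close>

text \<open>
  Three values of the distribution at length 4 suffice to separate all pairs that are not equivalent.
\<close>

definition profile :: "(nat list \<Rightarrow> nat) \<Rightarrow> nat list set \<Rightarrow> nat list" where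
  "profile st P = map (\<lambda>v. card {\<pi> \<in> avoiders 4 P. st \<pi> = v}) [1, 2, 3]"

lemma profile_eq: "st_Wilf_equiv st P Q \<Longrightarrow> profile st P = profile st Q"
  by (simp add: profile_def st_Wilf_equiv_def)

text \<open>
  The index triples of a list of length 4 are written out to make this condition executable by
  rewriting.
\<close>

fun occurs4 :: "nat list \<Rightarrow> nat list \<Rightarrow> bool" where
  "occurs4 \<pi> \<sigma> \<longleftrightarrow> list_ex (\<lambda>(i, j, k). (\<pi> ! i < \<pi> ! j \<longleftrightarrow> \<sigma> ! 0 < \<sigma> ! 1) \<and>
     (\<pi> ! i < \<pi> ! k \<longleftrightarrow> \<sigma> ! 0 < \<sigma> ! 2) \<and> (\<pi> ! j < \<pi> ! k \<longleftrightarrow> \<sigma> ! 1 < \<sigma> ! 2))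
     [(0, 1, 2), (0, 1, 3), (0, 2, 3), (1, 2, 3)]"

fun first_run :: "nat list \<Rightarrow> nat" where
  "first_run [] = 0"
| "first_run [x] = 1"
| "first_run (x # y # zs) = (if y < x then 1 else Suc (first_run (y # zs)))"

definition cuts :: "nat list \<Rightarrow> nat" where
  "cuts \<pi> = length (filter (\<lambda>i. list_all (\<lambda>x. x \<le> i) (take i \<pi>)) [1..<Suc (length \<pi>)])"

definition profile_list :: "(nat list \<Rightarrow> nat) \<Rightarrow> nat list list \<Rightarrow> nat list" where
  "profile_list st P = (let L = filter (\<lambda>\<pi>. \<not> list_ex (occurs4 \<pi>) P) (permutations_of_set_list [1, 2, 3, 4])
     in map (\<lambda>v. length (filter (\<lambda>\<pi>. st \<pi> = v) L)) [1, 2, 3])"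

lemma first_run: "iar \<pi> = first_run \<pi>"
proof (induction \<pi> rule: first_run.induct)
  case 1
  then show ?case by (simp add: iar_def)
qed (simp_all add: iar_Cons2)

lemma cuts: "comp_stat \<pi> = cuts \<pi>"
proof -
  have "{i \<in> {1..length \<pi>}. cut_at i \<pi>} =
      set (filter (\<lambda>i. list_all (\<lambda>x. x \<le> i) (take i \<pi>)) [1..<Suc (length \<pi>)])"
    by (auto simp: cut_at_def list_all_iff)
  then show ?thesis unfolding comp_stat_cut cuts_def by (simp only: distinct_card distinct_filter distinct_upt)
qed

lemma contains_occurs4:
  assumes "length \<pi> = 4"
  shows "contains \<pi> [a, b, c] \<longleftrightarrow> occurs4 \<pi> [a, b, c]"
proof -
  have idx: "i < j \<and> j < k \<and> k < 4 \<longleftrightarrow> (i, j, k) \<in> {(0, 1, 2), (0, 1, 3), (0, 2, 3), (1, 2, 3)}" for i j k :: nat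
    by auto
  have "contains \<pi> [a, b, c] \<longleftrightarrow> (\<exists>i j k. (i < j \<and> j < k \<and> k < 4) \<and> (\<pi> ! i < \<pi> ! j \<longleftrightarrow> a < b) \<and>
      (\<pi> ! i < \<pi> ! k \<longleftrightarrow> a < c) \<and> (\<pi> ! j < \<pi> ! k \<longleftrightarrow> b < c))"
    unfolding contains3 subseq3_nth assms by blast
  also have "\<dots> \<longleftrightarrow> occurs4 \<pi> [a, b, c]"
    unfolding idx by (simp add: list_ex_iff numeral_2_eq_2) blast
  finally show ?thesis .
qed

lemma profile_set:
  assumes "set P \<subseteq> perms 3"
  shows "profile st (set P) = profile_list st P"
proof -
  have "{1..4} = set [1, 2, 3, 4 :: nat]" by auto
  then have p4: "perms 4 = set (permutations_of_set_list [1, 2, 3, 4])"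
    using permutations_of_list[of "[1, 2, 3, 4 :: nat]"] by simp
  let ?L = "filter (\<lambda>\<pi>. \<not> list_ex (occurs4 \<pi>) P) (permutations_of_set_list [1, 2, 3, 4])"
  have "contains \<pi> \<sigma> \<longleftrightarrow> occurs4 \<pi> \<sigma>" if "\<pi> \<in> perms 4" "\<sigma> \<in> set P" for \<pi> \<sigma>
    using three_letter_patterns[OF assms that(2)] contains_occurs4[OF permsD(3)[OF that(1)]] by metis
  then have "avoiders 4 (set P) = set ?L"
    unfolding avoiders_def p4[symmetric] set_filter list_ex_iff by (auto simp: p4)
  then have "{\<pi> \<in> avoiders 4 (set P). st \<pi> = v} = set (filter (\<lambda>\<pi>. st \<pi> = v) ?L)" for v by auto
  moreover have "distinct ?L" by (intro distinct_filter distinct_permutations_of_set_list) simp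
  ultimately show ?thesis
    by (simp only: profile_def profile_list_def Let_def distinct_card distinct_filter)
qed

lemma profile_list_iar:
  "map (profile_list first_run)
    [[[1,2,3],[1,3,2]], [[1,2,3],[2,1,3]], [[1,2,3],[2,3,1]], [[1,2,3],[3,1,2]], [[1,2,3],[3,2,1]],
     [[1,3,2],[2,1,3]], [[1,3,2],[2,3,1]], [[1,3,2],[3,1,2]], [[1,3,2],[3,2,1]], [[2,1,3],[2,3,1]],
     [[2,1,3],[3,1,2]], [[2,1,3],[3,2,1]], [[2,3,1],[3,1,2]], [[2,3,1],[3,2,1]], [[3,1,2],[3,2,1]]] =
    [[6,2,0], [4,4,0], [6,1,0], [4,3,0], [2,2,0], [4,2,1], [7,0,0], [4,2,1], [3,2,1], [4,2,1],
     [1,3,3], [1,2,3], [4,2,1], [4,2,1], [2,2,3]]"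
  by code_simp

lemma profile_list_comp:
  "map (profile_list cuts)
    [[[1,2,3],[1,3,2]], [[1,2,3],[2,1,3]], [[1,2,3],[2,3,1]], [[1,2,3],[3,1,2]], [[1,2,3],[3,2,1]],
     [[1,3,2],[2,1,3]], [[1,3,2],[2,3,1]], [[1,3,2],[3,1,2]], [[1,3,2],[3,2,1]], [[2,1,3],[2,3,1]],
     [[2,1,3],[3,1,2]], [[2,1,3],[3,2,1]], [[2,3,1],[3,1,2]], [[2,3,1],[3,2,1]], [[3,1,2],[3,2,1]]] =
    [[7,1,0], [7,1,0], [4,3,0], [4,3,0], [3,1,0], [7,0,0], [4,2,1], [4,2,1], [3,2,1], [4,2,1],
     [4,2,1], [3,2,1], [1,3,3], [1,3,3], [1,3,3]]"
  by code_simp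

text \<open>
  The pairs are always listed in this order, so that the classes come out in a normal form.
\<close>

lemma pairs3_eq: "pairs3 =
  {{[1,2,3],[1,3,2]}, {[1,2,3],[2,1,3]}, {[1,2,3],[2,3,1]}, {[1,2,3],[3,1,2]}, {[1,2,3],[3,2,1]},
   {[1,3,2],[2,1,3]}, {[1,3,2],[2,3,1]}, {[1,3,2],[3,1,2]}, {[1,3,2],[3,2,1]}, {[2,1,3],[2,3,1]},
   {[2,1,3],[3,1,2]}, {[2,1,3],[3,2,1]}, {[2,3,1],[3,1,2]}, {[2,3,1],[3,2,1]}, {[3,1,2],[3,2,1]}}"
  (is "_ = ?R")
proof
  show "?R \<subseteq> pairs3"
    unfolding pairs3_def perms_3 by simp
  show "pairs3 \<subseteq> ?R"
  proof
    fix P assume "P \<in> pairs3"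
    then obtain x y where "P = {x, y}" "x \<noteq> y" "x \<in> perms 3" "y \<in> perms 3"
      unfolding pairs3_def card_2_iff by blast
    then show "P \<in> ?R"
      unfolding perms_3 by (elim insertE emptyE) (simp_all add: doubleton_eq_iff)
  qed
qed

lemma profile_pair: "{\<sigma>, \<tau>} \<subseteq> perms 3 \<Longrightarrow> profile st {\<sigma>, \<tau>} = profile_list st [\<sigma>, \<tau>]"
  using profile_set[of "[\<sigma>, \<tau>]"] by simp

lemma profile_iar:
  "profile iar {[1,2,3],[1,3,2]} = [6,2,0]" "profile iar {[1,2,3],[2,1,3]} = [4,4,0]"
  "profile iar {[1,2,3],[2,3,1]} = [6,1,0]" "profile iar {[1,2,3],[3,1,2]} = [4,3,0]"
  "profile iar {[1,2,3],[3,2,1]} = [2,2,0]" "profile iar {[1,3,2],[2,1,3]} = [4,2,1]"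
  "profile iar {[1,3,2],[2,3,1]} = [7,0,0]" "profile iar {[1,3,2],[3,1,2]} = [4,2,1]"
  "profile iar {[1,3,2],[3,2,1]} = [3,2,1]" "profile iar {[2,1,3],[2,3,1]} = [4,2,1]"
  "profile iar {[2,1,3],[3,1,2]} = [1,3,3]" "profile iar {[2,1,3],[3,2,1]} = [1,2,3]"
  "profile iar {[2,3,1],[3,1,2]} = [4,2,1]" "profile iar {[2,3,1],[3,2,1]} = [4,2,1]"
  "profile iar {[3,1,2],[3,2,1]} = [2,2,3]"
proof -
  have run: "iar = first_run" by (simp add: fun_eq_iff first_run)
  show
    "profile iar {[1,2,3],[1,3,2]} = [6,2,0]" "profile iar {[1,2,3],[2,1,3]} = [4,4,0]"
    "profile iar {[1,2,3],[2,3,1]} = [6,1,0]" "profile iar {[1,2,3],[3,1,2]} = [4,3,0]"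
    "profile iar {[1,2,3],[3,2,1]} = [2,2,0]" "profile iar {[1,3,2],[2,1,3]} = [4,2,1]"
    "profile iar {[1,3,2],[2,3,1]} = [7,0,0]" "profile iar {[1,3,2],[3,1,2]} = [4,2,1]"
    "profile iar {[1,3,2],[3,2,1]} = [3,2,1]" "profile iar {[2,1,3],[2,3,1]} = [4,2,1]"
    "profile iar {[2,1,3],[3,1,2]} = [1,3,3]" "profile iar {[2,1,3],[3,2,1]} = [1,2,3]"
    "profile iar {[2,3,1],[3,1,2]} = [4,2,1]" "profile iar {[2,3,1],[3,2,1]} = [4,2,1]"
    "profile iar {[3,1,2],[3,2,1]} = [2,2,3]"
    using profile_list_iar unfolding run patterns_3[THEN profile_pair] list.map list.inject by blast+
qed

lemma profile_comp:
  "profile comp_stat {[1,2,3],[1,3,2]} = [7,1,0]" "profile comp_stat {[1,2,3],[2,1,3]} = [7,1,0]"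
  "profile comp_stat {[1,2,3],[2,3,1]} = [4,3,0]" "profile comp_stat {[1,2,3],[3,1,2]} = [4,3,0]"
  "profile comp_stat {[1,2,3],[3,2,1]} = [3,1,0]" "profile comp_stat {[1,3,2],[2,1,3]} = [7,0,0]"
  "profile comp_stat {[1,3,2],[2,3,1]} = [4,2,1]" "profile comp_stat {[1,3,2],[3,1,2]} = [4,2,1]"
  "profile comp_stat {[1,3,2],[3,2,1]} = [3,2,1]" "profile comp_stat {[2,1,3],[2,3,1]} = [4,2,1]"
  "profile comp_stat {[2,1,3],[3,1,2]} = [4,2,1]" "profile comp_stat {[2,1,3],[3,2,1]} = [3,2,1]"
  "profile comp_stat {[2,3,1],[3,1,2]} = [1,3,3]" "profile comp_stat {[2,3,1],[3,2,1]} = [1,3,3]"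
  "profile comp_stat {[3,1,2],[3,2,1]} = [1,3,3]"
proof -
  have cuts: "comp_stat = cuts" by (simp add: fun_eq_iff cuts)
  show
    "profile comp_stat {[1,2,3],[1,3,2]} = [7,1,0]" "profile comp_stat {[1,2,3],[2,1,3]} = [7,1,0]"
    "profile comp_stat {[1,2,3],[2,3,1]} = [4,3,0]" "profile comp_stat {[1,2,3],[3,1,2]} = [4,3,0]"
    "profile comp_stat {[1,2,3],[3,2,1]} = [3,1,0]" "profile comp_stat {[1,3,2],[2,1,3]} = [7,0,0]"
    "profile comp_stat {[1,3,2],[2,3,1]} = [4,2,1]" "profile comp_stat {[1,3,2],[3,1,2]} = [4,2,1]"
    "profile comp_stat {[1,3,2],[3,2,1]} = [3,2,1]" "profile comp_stat {[2,1,3],[2,3,1]} = [4,2,1]"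
    "profile comp_stat {[2,1,3],[3,1,2]} = [4,2,1]" "profile comp_stat {[2,1,3],[3,2,1]} = [3,2,1]"
    "profile comp_stat {[2,3,1],[3,1,2]} = [1,3,3]" "profile comp_stat {[2,3,1],[3,2,1]} = [1,3,3]"
    "profile comp_stat {[3,1,2],[3,2,1]} = [1,3,3]"
    using profile_list_comp unfolding cuts patterns_3[THEN profile_pair] list.map list.inject by blast+
qed

section \<open>The equivalence classes\<close>

text \<open>
  With \<open>id\<close> the remaining comprehension occurs only once on the right-hand side, and evaluating a
  fifteen-element set stays linear.
\<close>

lemma Collect_insert: "{Q \<in> insert a B. f Q = c} = (if f a = c then insert a else id) {Q \<in> B. f Q = c}"
  by auto

lemma Collect_empty: "{Q \<in> {}. f Q = c} = {}"
  by simp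

lemma profile_complete_iar:
  "\<forall>P\<in>pairs3. \<forall>Q\<in>pairs3. profile iar P = profile iar Q \<longrightarrow> st_Wilf_equiv iar P Q"
proof (intro ballI impI)
  fix P Q assume assms: "P \<in> pairs3" "Q \<in> pairs3" "profile iar P = profile iar Q"
  let ?C = "{{[1,3,2],[2,1,3]}, {[1,3,2],[3,1,2]}, {[2,1,3],[2,3,1]}, {[2,3,1],[3,1,2]}, {[2,3,1],[3,2,1]}}"
  have eq: "P = Q \<or> P \<in> ?C \<and> Q \<in> ?C"
    using assms unfolding pairs3_eq
    by (elim insertE emptyE; hypsubst; simp add: profile_iar del: One_nat_def)
  have c: "st_mset iar (Suc n) R = add_mset (Suc n) (small_runs n)" if "R \<in> ?C" for R n
    using that by (elim insertE emptyE; hypsubst) (rule st_mset_iar)+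
  from eq show "st_Wilf_equiv iar P Q"
    by (elim disjE conjE) (simp add: st_Wilf_equiv_def, rule Wilf_equivI, erule c, erule c)
qed

lemma profile_complete_comp:
  "\<forall>P\<in>pairs3. \<forall>Q\<in>pairs3. profile comp_stat P = profile comp_stat Q \<longrightarrow> st_Wilf_equiv comp_stat P Q"
proof (intro ballI impI)
  fix P Q assume assms: "P \<in> pairs3" "Q \<in> pairs3" "profile comp_stat P = profile comp_stat Q"
  let ?A = "{{[1,3,2],[2,3,1]}, {[1,3,2],[3,1,2]}, {[2,1,3],[2,3,1]}, {[2,1,3],[3,1,2]}}"
  let ?B = "{{[1,2,3],[1,3,2]}, {[1,2,3],[2,1,3]}}"
  let ?C = "{{[2,3,1],[3,1,2]}, {[2,3,1],[3,2,1]}, {[3,1,2],[3,2,1]}}"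
  let ?D = "{{[1,3,2],[3,2,1]}, {[2,1,3],[3,2,1]}}"
  let ?E = "{{[1,2,3],[2,3,1]}, {[1,2,3],[3,1,2]}}"
  have eq: "P = Q \<or> P \<in> ?A \<and> Q \<in> ?A \<or> P \<in> ?B \<and> Q \<in> ?B \<or> P \<in> ?C \<and> Q \<in> ?C \<or>
      P \<in> ?D \<and> Q \<in> ?D \<or> P \<in> ?E \<and> Q \<in> ?E"
    using assms unfolding pairs3_eq
    by (elim insertE emptyE; hypsubst; simp add: profile_comp del: One_nat_def)
  have a: "st_mset comp_stat (Suc n) R = level rule_reset 1 n" if "R \<in> ?A" for R n
    using that by (elim insertE emptyE; hypsubst) (rule st_mset_comp_reset)+
  have b: "st_mset comp_stat (Suc n) R = image_mset fst (level rule_few (1, True) n)" if "R \<in> ?B" for R n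
    using that by (elim insertE emptyE; hypsubst) (rule st_mset_comp_few)+
  have c: "st_mset comp_stat (Suc n) R = level rule_stay 1 n" if "R \<in> ?C" for R n
    using that by (elim insertE emptyE; hypsubst) (rule st_mset_comp_stay)+
  have d: "st_mset comp_stat (Suc n) R = image_mset fst (level rule_rise (1, True, True) n)" if "R \<in> ?D" for R n
    using that by (elim insertE emptyE; hypsubst) (rule st_mset_comp_rise)+
  have e: "st_mset comp_stat (Suc n) R = image_mset fst (level rule_fall (1, True, True) n)" if "R \<in> ?E" for R n
    using that by (elim insertE emptyE; hypsubst) (rule st_mset_comp_fall)+
  from eq show "st_Wilf_equiv comp_stat P Q"
    by (elim disjE conjE) (simp add: st_Wilf_equiv_def, (rule Wilf_equivI, erule a, erule a),
      (rule Wilf_equivI, erule b, erule b), (rule Wilf_equivI, erule c, erule c),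
      (rule Wilf_equivI, erule d, erule d), (rule Wilf_equivI, erule e, erule e))
qed

text \<open>
  Once equal profiles are known to imply equivalence, the profile is a complete invariant and the
  classes are its fibres.
\<close>

lemma quotient_profile:
  assumes "\<forall>P\<in>pairs3. \<forall>Q\<in>pairs3. profile st P = profile st Q \<longrightarrow> st_Wilf_equiv st P Q"
    and "A \<subseteq> pairs3"
  shows "A // Wilf_rel st = (\<lambda>c. {Q \<in> pairs3. profile st Q = c}) ` profile st ` A"
proof -
  have "Wilf_rel st `` {P} = {Q \<in> pairs3. profile st Q = profile st P}" if "P \<in> A" for P
    unfolding Wilf_rel_def using assms that by (auto dest: profile_eq)
  then show ?thesis by (auto simp: quotient_def)
qed

lemma card_quotient_profile:
  assumes "\<forall>P\<in>pairs3. \<forall>Q\<in>pairs3. profile st P = profile st Q \<longrightarrow> st_Wilf_equiv st P Q"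
  shows "card (pairs3 // Wilf_rel st) = card (profile st ` pairs3)"
proof -
  have "inj_on (\<lambda>c. {Q \<in> pairs3. profile st Q = c}) (profile st ` pairs3)"
    by (auto simp: inj_on_def)
  then show ?thesis
    unfolding quotient_profile[OF assms order_refl] by (rule card_image)
qed

lemma monotone_triple_of_five:
  fixes a b c d e :: nat
  assumes "a \<noteq> b" "b \<noteq> c" "b \<noteq> d" "b \<noteq> e" "c \<noteq> d" "d \<noteq> e"
  shows "(a < b \<and> b < c) \<or> (b < a \<and> c < b) \<or> (a < b \<and> b < d) \<or> (b < a \<and> d < b) \<or>
    (a < b \<and> b < e) \<or> (b < a \<and> e < b) \<or> (b < c \<and> c < d) \<or> (c < b \<and> d < c) \<or>
    (b < d \<and> d < e) \<or> (d < b \<and> e < d) \<or> (c < d \<and> d < e) \<or> (d < c \<and> e < d)"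
  using assms unfolding nat_neq_iff by (elim disjE) simp_all

text \<open>
  An instance of the Erdos-Szekeres theorem: five distinct numbers contain a monotone triple.
\<close>

lemma avoiders_123_321:
  assumes "5 \<le> n"
  shows "avoiders n {[1,2,3],[3,2,1]} = {}"
proof (rule equals0I)
  fix \<pi> assume p: "\<pi> \<in> avoiders n {[1,2,3],[3,2,1]}"
  note q = permsD[OF avoidersD(1)[OF p]]
  have ne: "\<pi> ! i \<noteq> \<pi> ! j" if "i < j" "j < 5" for i j
    using that assms q(1,3) by (simp add: nth_eq_iff_index_eq)
  have no: "\<not> (\<pi> ! i < \<pi> ! j \<and> \<pi> ! j < \<pi> ! k) \<and> \<not> (\<pi> ! j < \<pi> ! i \<and> \<pi> ! k < \<pi> ! j)"
    if "i < j" "j < k" "k < 5" for i j k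
  proof -
    have "k < length \<pi>" using that assms q(3) by simp
    then have "subseq [\<pi> ! i, \<pi> ! j, \<pi> ! k] \<pi>" unfolding subseq3_nth using that by blast
    from avoids3[OF p _ this, of 1 2 3] avoids3[OF p _ this, of 3 2 1] show ?thesis by auto
  qed
  show False
    using monotone_triple_of_five[OF ne[of 0 1] ne[of 1 2] ne[of 1 3] ne[of 1 4] ne[of 2 3] ne[of 3 4]]
      no[of 0 1 2] no[of 0 1 3] no[of 0 1 4] no[of 1 2 3] no[of 1 3 4] no[of 2 3 4] by auto
qed

text \<open>
  Length 5 tells the three growth types apart: the cardinalities there are 16, 11 and 0.
\<close>

lemma pow2_pairs_eq: "pow2_pairs =
  {{[1,2,3],[1,3,2]}, {[1,2,3],[2,1,3]}, {[1,3,2],[2,1,3]}, {[1,3,2],[2,3,1]}, {[1,3,2],[3,1,2]},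
   {[2,1,3],[2,3,1]}, {[2,1,3],[3,1,2]}, {[2,3,1],[3,1,2]}, {[2,3,1],[3,2,1]}, {[3,1,2],[3,2,1]}}"
  (is "_ = ?T")
  and binom_pairs_eq: "binom_pairs =
  {{[1,2,3],[2,3,1]}, {[1,2,3],[3,1,2]}, {[1,3,2],[3,2,1]}, {[2,1,3],[3,2,1]}}"
  (is "_ = ?B")
proof -
  have pow: "card (avoiders n P) = 2 ^ (n - 1)" if P: "P \<in> ?T" and n1: "1 \<le> n" for n P
  proof -
    obtain k where n: "n = Suc k" using n1 by (cases n) auto
    have "card (avoiders (Suc k) P) = 2 ^ k"
      using P by (elim insertE emptyE; hypsubst) (rule card_avoiders_pow2_iar card_avoiders_pow2_comp)+
    then show ?thesis by (simp add: n)
  qed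
  have bin: "card (avoiders n P) = 1 + (n choose 2)" if P: "P \<in> ?B" and n1: "1 \<le> n" for n P
  proof -
    obtain k where n: "n = Suc k" using n1 by (cases n) auto
    show ?thesis unfolding n
      using P by (elim insertE emptyE; hypsubst) (rule card_avoiders_binom)+
  qed
  have parts: "pairs3 = ?T \<union> ?B \<union> {{[1,2,3],[3,2,1]}}"
    unfolding pairs3_eq
    by (intro equalityI subsetI; elim UnE insertE emptyE; hypsubst; simp only: insert_iff Un_iff simp_thms)
  have zero: "card (avoiders 5 {[1,2,3],[3,2,1]}) = 0"
    using avoiders_123_321[of 5] by simp
  have not_pow: "\<not> (\<forall>n\<ge>1. card (avoiders n P) = 2 ^ (n - 1))" if "P \<in> ?B \<union> {{[1,2,3],[3,2,1]}}" for P
  proof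
    assume all: "\<forall>n\<ge>1. card (avoiders n P) = 2 ^ (n - 1)"
    from all have "card (avoiders 5 P) = 2 ^ (5 - 1)" by (rule allE[of _ 5]) simp
    moreover from that have "card (avoiders 5 P) = 1 + (5 choose 2) \<or> card (avoiders 5 P) = 0"
    proof
      assume "P \<in> ?B"
      then have "card (avoiders 5 P) = 1 + (5 choose 2)" by (rule bin) simp
      then show ?thesis ..
    next
      assume "P \<in> {{[1,2,3],[3,2,1]}}"
      then have "P = {[1,2,3],[3,2,1]}" by (rule singletonD)
      then show ?thesis using zero by (simp only: simp_thms)
    qed
    ultimately show False by (simp add: numeral_eq_Suc)
  qed
  have not_bin: "\<not> (\<forall>n\<ge>1. card (avoiders n P) = 1 + (n choose 2))" if "P \<in> ?T \<union> {{[1,2,3],[3,2,1]}}" for P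
  proof
    assume all: "\<forall>n\<ge>1. card (avoiders n P) = 1 + (n choose 2)"
    from all have "card (avoiders 5 P) = 1 + (5 choose 2)" by (rule allE[of _ 5]) simp
    moreover from that have "card (avoiders 5 P) = 2 ^ (5 - 1) \<or> card (avoiders 5 P) = 0"
    proof
      assume "P \<in> ?T"
      then have "card (avoiders 5 P) = 2 ^ (5 - 1)" by (rule pow) simp
      then show ?thesis ..
    next
      assume "P \<in> {{[1,2,3],[3,2,1]}}"
      then have "P = {[1,2,3],[3,2,1]}" by (rule singletonD)
      then show ?thesis using zero by (simp only: simp_thms)
    qed
    ultimately show False by (simp add: numeral_eq_Suc)
  qed
  have split: "{P \<in> A \<union> B. \<phi> P} = A" if "\<And>P. P \<in> A \<Longrightarrow> \<phi> P" "\<And>P. P \<in> B \<Longrightarrow> \<not> \<phi> P"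
    for A B :: "nat list set set" and \<phi>
    using that by auto
  show "pow2_pairs = ?T"
    unfolding pow2_pairs_def parts Un_assoc
  proof (rule split)
    show "\<forall>n\<ge>1. card (avoiders n P) = 2 ^ (n - 1)" if "P \<in> ?T" for P
      by (intro allI impI pow[OF that])
  qed (rule not_pow)
  have "pairs3 = ?B \<union> (?T \<union> {{[1,2,3],[3,2,1]}})"
    unfolding parts by (simp only: Un_assoc Un_left_commute)
  then show "binom_pairs = ?B"
    unfolding binom_pairs_def
  proof (elim ssubst, intro split)
    show "\<forall>n\<ge>1. card (avoiders n P) = 1 + (n choose 2)" if "P \<in> ?B" for P
      by (intro allI impI bin[OF that])
  qed (rule not_bin)
qed

lemma class_iar:
  "{Q \<in> pairs3. profile iar Q = [6,2,0]} = {{[1,2,3],[1,3,2]}}"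
  "{Q \<in> pairs3. profile iar Q = [4,4,0]} = {{[1,2,3],[2,1,3]}}"
  "{Q \<in> pairs3. profile iar Q = [6,1,0]} = {{[1,2,3],[2,3,1]}}"
  "{Q \<in> pairs3. profile iar Q = [4,3,0]} = {{[1,2,3],[3,1,2]}}"
  "{Q \<in> pairs3. profile iar Q = [2,2,0]} = {{[1,2,3],[3,2,1]}}"
  "{Q \<in> pairs3. profile iar Q = [4,2,1]} = {{[1,3,2],[2,1,3]}, {[1,3,2],[3,1,2]}, {[2,1,3],[2,3,1]}, {[2,3,1],[3,1,2]}, {[2,3,1],[3,2,1]}}"
  "{Q \<in> pairs3. profile iar Q = [7,0,0]} = {{[1,3,2],[2,3,1]}}"
  "{Q \<in> pairs3. profile iar Q = [3,2,1]} = {{[1,3,2],[3,2,1]}}"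
  "{Q \<in> pairs3. profile iar Q = [1,3,3]} = {{[2,1,3],[3,1,2]}}"
  "{Q \<in> pairs3. profile iar Q = [1,2,3]} = {{[2,1,3],[3,2,1]}}"
  "{Q \<in> pairs3. profile iar Q = [2,2,3]} = {{[3,1,2],[3,2,1]}}"
  unfolding pairs3_eq Collect_insert Collect_empty profile_iar by simp_all

lemma class_comp:
  "{Q \<in> pairs3. profile comp_stat Q = [7,1,0]} = {{[1,2,3],[1,3,2]}, {[1,2,3],[2,1,3]}}"
  "{Q \<in> pairs3. profile comp_stat Q = [4,3,0]} = {{[1,2,3],[2,3,1]}, {[1,2,3],[3,1,2]}}"
  "{Q \<in> pairs3. profile comp_stat Q = [3,1,0]} = {{[1,2,3],[3,2,1]}}"
  "{Q \<in> pairs3. profile comp_stat Q = [7,0,0]} = {{[1,3,2],[2,1,3]}}"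
  "{Q \<in> pairs3. profile comp_stat Q = [4,2,1]} = {{[1,3,2],[2,3,1]}, {[1,3,2],[3,1,2]}, {[2,1,3],[2,3,1]}, {[2,1,3],[3,1,2]}}"
  "{Q \<in> pairs3. profile comp_stat Q = [3,2,1]} = {{[1,3,2],[3,2,1]}, {[2,1,3],[3,2,1]}}"
  "{Q \<in> pairs3. profile comp_stat Q = [1,3,3]} = {{[2,3,1],[3,1,2]}, {[2,3,1],[3,2,1]}, {[3,1,2],[3,2,1]}}"
  unfolding pairs3_eq Collect_insert Collect_empty profile_comp by simp_all

lemma quotients:
  "pow2_pairs // Wilf_rel iar = (\<lambda>c. {Q \<in> pairs3. profile iar Q = c}) ` profile iar ` pow2_pairs"
  "binom_pairs // Wilf_rel iar = (\<lambda>c. {Q \<in> pairs3. profile iar Q = c}) ` profile iar ` binom_pairs"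
  "pairs3 // Wilf_rel iar = (\<lambda>c. {Q \<in> pairs3. profile iar Q = c}) ` profile iar ` pairs3"
  "pow2_pairs // Wilf_rel comp_stat = (\<lambda>c. {Q \<in> pairs3. profile comp_stat Q = c}) ` profile comp_stat ` pow2_pairs"
  "binom_pairs // Wilf_rel comp_stat = (\<lambda>c. {Q \<in> pairs3. profile comp_stat Q = c}) ` profile comp_stat ` binom_pairs"
  by (rule quotient_profile[OF profile_complete_iar] quotient_profile[OF profile_complete_comp];
      simp add: pow2_pairs_def binom_pairs_def)+

theorem mainTheorem5:
  shows "card pairs3 = 15 \<and>
    card (pairs3 // Wilf_rel iar) = 11 \<and>
    pow2_pairs // Wilf_rel iar =
      {{{[1,3,2],[2,1,3]}, {[1,3,2],[3,1,2]}, {[2,1,3],[2,3,1]}, {[2,3,1],[3,1,2]}, {[2,3,1],[3,2,1]}},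
       {{[1,3,2],[2,3,1]}},
       {{[2,1,3],[3,1,2]}},
       {{[3,1,2],[3,2,1]}},
       {{[1,2,3],[1,3,2]}},
       {{[1,2,3],[2,1,3]}}} \<and>
    binom_pairs // Wilf_rel iar =
      {{{[1,3,2],[3,2,1]}},
       {{[1,2,3],[2,3,1]}},
       {{[2,1,3],[3,2,1]}},
       {{[1,2,3],[3,1,2]}}} \<and>
    {{[1,2,3],[3,2,1]}} \<in> pairs3 // Wilf_rel iar \<and>
    (\<forall>n\<ge>5. card (avoiders n {[1,2,3],[3,2,1]}) = 0) \<and>
    pow2_pairs // Wilf_rel comp_stat =
      {{{[1,3,2],[2,3,1]}, {[1,3,2],[3,1,2]}, {[2,1,3],[2,3,1]}, {[2,1,3],[3,1,2]}},
       {{[1,3,2],[2,1,3]}},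
       {{[1,2,3],[1,3,2]}, {[1,2,3],[2,1,3]}},
       {{[2,3,1],[3,1,2]}, {[2,3,1],[3,2,1]}, {[3,1,2],[3,2,1]}}} \<and>
    binom_pairs // Wilf_rel comp_stat =
      {{{[1,3,2],[3,2,1]}, {[2,1,3],[3,2,1]}},
       {{[1,2,3],[2,3,1]}, {[1,2,3],[3,1,2]}}}"
proof (intro conjI)
  show "card pairs3 = 15"
    unfolding pairs3_eq by (simp add: doubleton_eq_iff)
  show "card (pairs3 // Wilf_rel iar) = 11"
    unfolding card_quotient_profile[OF profile_complete_iar]
    unfolding pairs3_eq image_insert image_empty profile_iar by (simp add: card_insert_if)
  show "pow2_pairs // Wilf_rel iar =
      {{{[1,3,2],[2,1,3]}, {[1,3,2],[3,1,2]}, {[2,1,3],[2,3,1]}, {[2,3,1],[3,1,2]}, {[2,3,1],[3,2,1]}},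
       {{[1,3,2],[2,3,1]}},
       {{[2,1,3],[3,1,2]}},
       {{[3,1,2],[3,2,1]}},
       {{[1,2,3],[1,3,2]}},
       {{[1,2,3],[2,1,3]}}}"
    unfolding quotients unfolding pow2_pairs_eq image_insert image_empty profile_iar class_iar
    by (simp only: insert_commute insert_absorb2)
  show "binom_pairs // Wilf_rel iar =
      {{{[1,3,2],[3,2,1]}},
       {{[1,2,3],[2,3,1]}},
       {{[2,1,3],[3,2,1]}},
       {{[1,2,3],[3,1,2]}}}"
    unfolding quotients unfolding binom_pairs_eq image_insert image_empty profile_iar class_iar
    by (simp only: insert_commute insert_absorb2)
  have "{[1,2,3],[3,2,1]} \<in> pairs3"
    unfolding pairs3_eq by simp
  then have "(\<lambda>c. {Q \<in> pairs3. profile iar Q = c}) (profile iar {[1,2,3],[3,2,1]}) \<in> pairs3 // Wilf_rel iar"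
    unfolding quotients by (intro imageI)
  then show "{{[1,2,3],[3,2,1]}} \<in> pairs3 // Wilf_rel iar"
    by (simp only: profile_iar class_iar)
  show "\<forall>n\<ge>5. card (avoiders n {[1,2,3],[3,2,1]}) = 0"
    using avoiders_123_321 by simp
  show "pow2_pairs // Wilf_rel comp_stat =
      {{{[1,3,2],[2,3,1]}, {[1,3,2],[3,1,2]}, {[2,1,3],[2,3,1]}, {[2,1,3],[3,1,2]}},
       {{[1,3,2],[2,1,3]}},
       {{[1,2,3],[1,3,2]}, {[1,2,3],[2,1,3]}},
       {{[2,3,1],[3,1,2]}, {[2,3,1],[3,2,1]}, {[3,1,2],[3,2,1]}}}"
    unfolding quotients unfolding pow2_pairs_eq image_insert image_empty profile_comp class_comp
    by (simp only: insert_commute insert_absorb2)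
  show "binom_pairs // Wilf_rel comp_stat =
      {{{[1,3,2],[3,2,1]}, {[2,1,3],[3,2,1]}},
       {{[1,2,3],[2,3,1]}, {[1,2,3],[3,1,2]}}}"
    unfolding quotients unfolding binom_pairs_eq image_insert image_empty profile_comp class_comp
    by (simp only: insert_commute insert_absorb2)
qed

end
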